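(* Let $\mathbf{a}\in\mathfrak{A}_3$ with $a_{(12)}\neq a_{(13)}=a_{(23)}$. Write $M=M_{(13)(23)}$ for the Verma module and put, in $M$, $m_{\mathsf{soc}}=f_{13}((23))f_{23}((13))\,m_1-m_{\mathrm{top}}$, $m_{\mathsf{o}}=m_{(13)(12)(13)}+f_{13}((23))\,m_{(23)}$ and $N_{(13)(23)}=\mathcal{A}_{[\mathbf{a}]}\cdot\bigl(M[e]\oplus M[(12)]\bigr)$. Let $v$ and $w$ stand for elements satisfying $M[e]=\langle v,m_{(12)(23)}\rangle$ and $M[(12)]=\langle w,m_{\mathsf{o}}\rangle$. The proper nonzero submodules of $M$ are exactly $$N_{(13)(23)},\quad \mathcal{A}_{[\mathbf{a}]}\cdot M[e],\quad \mathcal{A}_{[\mathbf{a}]}\cdot M[(12)],\quad \mathcal{A}_{[\mathbf{a}]}\cdot v,\quad \mathcal{A}_{[\mathbf{a}]}\cdot\langle m_{\mathsf{o}},m_{(12)(23)}\rangle,$$ $$\mathcal{A}_{[\mathbf{a}]}\cdot w,\quad \mathcal{A}_{[\mathbf{a}]}\cdot m_{\mathsf{o}},\quad \mathcal{A}_{[\mathbf{a}]}\cdot m_{(12)(23)},\quad \mathcal{A}_{[\mathbf{a}]}\cdot m_{\mathsf{soc}},$$ where $v$ runs over all elements of $M[e]$ with $M[e]=\langle v,m_{(12)(23)}\rangle$ and $w$ runs over all elements of $M[(12)]$ with $M[(12)]=\langle w,m_{\mathsf{o}}\rangle$. The Hasse diagram of this lattice is given by the following covering inclusions $X\supset Y$,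 where $X\overset{Q}{\supset}Y$ means in addition $X/Y\simeq Q$ (for every such $v$, $w$): - $N_{(13)(23)}\overset{\Bbbk_{(12)}}{\supset}\mathcal{A}_{[\mathbf{a}]}\cdot M[e]$ and $N_{(13)(23)}\overset{\Bbbk_e}{\supset}\mathcal{A}_{[\mathbf{a}]}\cdot M[(12)]$; - $\mathcal{A}_{[\mathbf{a}]}\cdot M[e]\overset{\Bbbk_e}{\supset}\mathcal{A}_{[\mathbf{a}]}\cdot v$ and $\mathcal{A}_{[\mathbf{a}]}\cdot M[e]\overset{\Bbbk_e}{\supset}\mathcal{A}_{[\mathbf{a}]}\cdot\langle m_{\mathsf{o}},m_{(12)(23)}\rangle$; - $\mathcal{A}_{[\mathbf{a}]}\cdot M[(12)]\overset{\Bbbk_{(12)}}{\supset}\mathcal{A}_{[\mathbf{a}]}\cdot w$ and $\mathcal{A}_{[\mathbf{a}]}\cdot M[(12)]\overset{\Bbbk_{(12)}}{\supset}\mathcal{A}_{[\mathbf{a}]}\cdot\langle m_{\mathsf{o}},m_{(12)(23)}\rangle$; - $\mathcal{A}_{[\mathbf{a}]}\cdot v\overset{\Bbbk_e}{\supset}\mathcal{A}_{[\mathbf{a}]}\cdot m_{\mathsf{o}}$ and $\mathcal{A}_{[\mathbf{a}]}\cdot w\overset{\Bbbk_{(12)}}{\supset}\mathcal{A}_{[\mathbf{a}]}\cdot m_{(12)(23)}$; - $\mathcal{A}_{[\mathbf{a}]}\cdot\langle m_{\mathsf{o}},m_{(12)(23)}\rangle\overset{\Bbbk_e}{\supset}\mathcal{A}_{[\mathbf{a}]}\cdot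 m_{\mathsf{o}}$ and $\mathcal{A}_{[\mathbf{a}]}\cdot\langle m_{\mathsf{o}},m_{(12)(23)}\rangle\overset{\Bbbk_{(12)}}{\supset}\mathcal{A}_{[\mathbf{a}]}\cdot m_{(12)(23)}$; - $\mathcal{A}_{[\mathbf{a}]}\cdot m_{\mathsf{o}}\overset{\Bbbk_{(12)}}{\supset}\mathcal{A}_{[\mathbf{a}]}\cdot m_{\mathsf{soc}}$ and $\mathcal{A}_{[\mathbf{a}]}\cdot m_{(12)(23)}\overset{\Bbbk_e}{\supset}\mathcal{A}_{[\mathbf{a}]}\cdot m_{\mathsf{soc}}$. The submodules $\mathcal{A}_{[\mathbf{a}]}\cdot v$ and $\mathcal{A}_{[\mathbf{a}]}\cdot v_1$ (resp. $\mathcal{A}_{[\mathbf{a}]}\cdot w$ and $\mathcal{A}_{[\mathbf{a}]}\cdot w_1$) coincide if and only if $v\in\langle v_1\rangle$ (resp. $w\in\langle w_1\rangle$), for $v,v_1$ with $M[e]=\langle v,m_{(12)(23)}\rangle=\langle v_1,m_{(12)(23)}\rangle$ (resp. $w,w_1$ with $M[(12)]=\langle w,m_{\mathsf{o}}\rangle=\langle w_1,m_{\mathsf{o}}\rangle$).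
   Context: $\Bbbk$ is an algebraically closed field of characteristic $0$; $\langle S\rangle$ denotes the linear span of $S$. $\mathcal{O}_2^3=\{(12),(13),(23)\}\subset\mathbb{S}_3$; $\Bbbk^{\mathbb{S}_3}$ is the algebra of functions on $\mathbb{S}_3$ with basis the characteristic functions $\delta_g$ of $\{g\}$, $g\in\mathbb{S}_3$. $\mathfrak{A}_3=\{\mathbf{a}=(a_{(12)},a_{(13)},a_{(23)})\in\Bbbk^3: a_{(12)}+a_{(13)}+a_{(23)}=0\}$. For $\mathbf{a}\in\mathfrak{A}_3$ and $(ij)\in\mathcal{O}_2^3$ put $f_{ij}=\sum_{g\in\mathbb{S}_3}(a_{(ij)}-a_{g^{-1}(ij)g})\delta_g\in\Bbbk^{\mathbb{S}_3}$. $\mathcal{A}_{[\mathbf{a}]}$ is the algebra generated by $\Bbbk^{\mathbb{S}_3}$ and $x_{(12)},x_{(13)},x_{(23)}$ with relations $\delta_h x_{(ij)}=x_{(ij)}\delta_{(ij)h}$ ($h\in\mathbb{S}_3$), $x_{(ij)}^2=f_{ij}$, $x_{(13)}x_{(23)}+x_{(23)}x_{(12)}+x_{(12)}x_{(13)}=0$ and $x_{(23)}x_{(13)}+x_{(13)}x_{(12)}+x_{(12)}x_{(23)}=0$. (It is known to have dimension $72$ and to contain $\Bbbk^{\mathbb{S}_3}$ as a subalgebra.) Modules are left modules. For an $\mathcal{A}_{[\mathbf{a}]}$-module $M$ and $g\in\mathbb{S}_3$, $M[g]=\delta_g\cdot M$. The Verma module is $M_g=\mathcal{A}_{[\mathbf{a}]}\otimes_{\Bbbk^{\mathbb{S}_3}}\Bbbk_g$,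 where $\Bbbk_g$ is the one-dimensional $\Bbbk^{\mathbb{S}_3}$-module with $f\cdot 1=f(g)1$. In $M_g$ write $m_1=1\otimes1$, $m_{(ij)\cdots(rs)}=x_{(ij)}\cdots x_{(rs)}\otimes 1$ and $m_{\mathrm{top}}=m_{(13)(12)(23)(12)}$. For a subspace $U$ of a module, $\mathcal{A}_{[\mathbf{a}]}\cdot U$ is the submodule it generates. Assume $a_{(12)}\neq a_{(13)}=a_{(23)}$. For $h\in\{e,(12)\}$, $\Bbbk_h$ also denotes the one-dimensional $\mathcal{A}_{[\mathbf{a}]}$-module on which every $x_{(ij)}$ acts by $0$ and $f\in\Bbbk^{\mathbb{S}_3}$ acts by $f(h)$. *)

theory Defs
  imports
    "HOL-Algebra.Algebraic_Closure_Type"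
    "HOL-Algebra.Module"
    "HOL-Algebra.QuotRing"
    "HOL-Algebra.Generated_Groups"
    "HOL-Combinatorics.Perm"
    "HOL-Library.Poly_Mapping"
    "HOL-Library.Numeral_Type"
begin

section \<open>Free associative algebras\<close>

datatype 'g word = Word (letters: "'g list")

instantiation word :: (type) monoid_add
begin

definition "0 = Word []"

definition "u + v = Word (letters u @ letters v)"

instance
  by standard (simp_all add: zero_word_def plus_word_def)

end

text \<open>
  The free unital algebra on \<open>'g\<close> is the monoid algebra of words; its (concatenation) product is the
  convolution product that \<^theory>\<open>HOL-Library.Poly_Mapping\<close> puts on
  \<^typ>\<open>'g word \<Rightarrow>\<^sub>0 'k\<close>.
\<close>

type_synonym ('g, 'k) free_algebra = "'g word \<Rightarrow>\<^sub>0 'k"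

definition letter :: "'g \<Rightarrow> ('g, 'k::comm_ring_1) free_algebra" where
  "letter s = Poly_Mapping.single (Word [s]) 1"

definition const :: "'k \<Rightarrow> ('g, 'k::comm_ring_1) free_algebra" where
  "const c = Poly_Mapping.single 0 c"

definition eval :: "('g \<Rightarrow> 'k) \<Rightarrow> ('g, 'k::comm_ring_1) free_algebra \<Rightarrow> 'k" where
  "eval \<phi> p = (\<Sum>w\<in>Poly_Mapping.keys p. Poly_Mapping.lookup p w * prod_list (map \<phi> (letters w)))"


section \<open>Left modules over a not necessarily commutative ring\<close>

text \<open>
  Modules are \<^typ>\<open>('r, 'm) module\<close> records and submodules are given by \<^const>\<open>submodule\<close>; neither
  requires the ring to be commutative (only the locale \<^locale>\<open>module\<close> does, and it is not used).
  The multiplicative fields of these records play no role.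
\<close>

definition generated_submodule ::
    "('r, 'c) ring_scheme \<Rightarrow> ('r, 'm, 'd) module_scheme \<Rightarrow> 'm set \<Rightarrow> 'm set" where
  "generated_submodule R M S = \<Inter>{N. submodule N R M \<and> S \<subseteq> N}"

definition quotient_module ::
    "('r, 'm, 'd) module_scheme \<Rightarrow> 'm set \<Rightarrow> ('r, 'm set) module" where
  "quotient_module M N =
     \<lparr>carrier = a_rcosets\<^bsub>M\<^esub> N, monoid.mult = undefined, one = undefined,
      ring.zero = N, add = set_add M,
      module.smult = (\<lambda>r C. \<Union>m\<in>C. N +>\<^bsub>M\<^esub> (r \<odot>\<^bsub>M\<^esub> m))\<rparr>"

definition restrict_scalars ::
    "('s \<Rightarrow> 'r) \<Rightarrow> ('r, 'm, 'd) module_scheme \<Rightarrow> ('s, 'm) module" where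
  "restrict_scalars \<phi> M =
     \<lparr>carrier = carrier M, monoid.mult = undefined, one = undefined,
      ring.zero = \<zero>\<^bsub>M\<^esub>, add = add M, module.smult = (\<lambda>s. module.smult M (\<phi> s))\<rparr>"

definition module_isomorphic ::
    "('r, 'c) ring_scheme \<Rightarrow> ('r, 'm, 'd) module_scheme \<Rightarrow> ('r, 'n, 'e) module_scheme \<Rightarrow> bool" where
  "module_isomorphic R M N \<longleftrightarrow>
     (\<exists>f \<in> iso (add_monoid M) (add_monoid N).
        \<forall>r\<in>carrier R. \<forall>m\<in>carrier M. f (r \<odot>\<^bsub>M\<^esub> m) = r \<odot>\<^bsub>N\<^esub> f m)"


section \<open>Extension of scalars \<open>R \<otimes>\<^sub>B N\<close>\<close>

text \<open>
  The free abelian group on \<open>carrier R \<times> carrier N\<close>, with \<open>r\<close> acting by \<open>(s, n) \<mapsto> (r s, n)\<close>. This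
  action is additive in \<open>r\<close> only modulo the relations below.
\<close>

definition free_pairs ::
    "('r, 'c) ring_scheme \<Rightarrow> ('b, 'n, 'd) module_scheme \<Rightarrow> ('r, ('r \<times> 'n) \<Rightarrow>\<^sub>0 int) module" where
  "free_pairs R N =
     \<lparr>carrier = {p. Poly_Mapping.keys p \<subseteq> carrier R \<times> carrier N},
      monoid.mult = undefined, one = undefined, ring.zero = 0, add = (+),
      module.smult = (\<lambda>r. frag_extend (\<lambda>(s, n). frag_of (r \<otimes>\<^bsub>R\<^esub> s, n)))\<rparr>"

definition tensor_relations ::
    "('r, 'c) ring_scheme \<Rightarrow> ('b, 'e) ring_scheme \<Rightarrow> ('b \<Rightarrow> 'r) \<Rightarrow> ('b, 'n, 'd) module_scheme \<Rightarrow>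
     (('r \<times> 'n) \<Rightarrow>\<^sub>0 int) set" where
  "tensor_relations R B \<phi> N =
     {frag_of (r \<oplus>\<^bsub>R\<^esub> s, n) - frag_of (r, n) - frag_of (s, n) | r s n.
        r \<in> carrier R \<and> s \<in> carrier R \<and> n \<in> carrier N} \<union>
     {frag_of (r, n \<oplus>\<^bsub>N\<^esub> n') - frag_of (r, n) - frag_of (r, n') | r n n'.
        r \<in> carrier R \<and> n \<in> carrier N \<and> n' \<in> carrier N} \<union>
     {frag_of (r \<otimes>\<^bsub>R\<^esub> \<phi> b, n) - frag_of (r, b \<odot>\<^bsub>N\<^esub> n) | r b n.
        r \<in> carrier R \<and> b \<in> carrier B \<and> n \<in> carrier N}"

definition tensor_kernel ::
    "('r, 'c) ring_scheme \<Rightarrow> ('b, 'e) ring_scheme \<Rightarrow> ('b \<Rightarrow> 'r) \<Rightarrow> ('b, 'n, 'd) module_scheme \<Rightarrow>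
     (('r \<times> 'n) \<Rightarrow>\<^sub>0 int) set" where
  "tensor_kernel R B \<phi> N =
     generate (add_monoid (free_pairs R N)) (tensor_relations R B \<phi> N)"

definition tensor_module ::
    "('r, 'c) ring_scheme \<Rightarrow> ('b, 'e) ring_scheme \<Rightarrow> ('b \<Rightarrow> 'r) \<Rightarrow> ('b, 'n, 'd) module_scheme \<Rightarrow>
     ('r, (('r \<times> 'n) \<Rightarrow>\<^sub>0 int) set) module" where
  "tensor_module R B \<phi> N = quotient_module (free_pairs R N) (tensor_kernel R B \<phi> N)"

definition pure_tensor ::
    "('r, 'c) ring_scheme \<Rightarrow> ('b, 'e) ring_scheme \<Rightarrow> ('b \<Rightarrow> 'r) \<Rightarrow> ('b, 'n, 'd) module_scheme \<Rightarrow>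
     'r \<Rightarrow> 'n \<Rightarrow> (('r \<times> 'n) \<Rightarrow>\<^sub>0 int) set" where
  "pure_tensor R B \<phi> N r n = tensor_kernel R B \<phi> N +>\<^bsub>free_pairs R N\<^esub> frag_of (r, n)"


section \<open>The symmetric group on three letters and its transpositions\<close>

text \<open>The letters are the elements \<open>1\<close>, \<open>2\<close>, \<open>3\<close> of the three-element type \<^typ>\<open>3\<close> (where \<open>3 = 0\<close>).\<close>

type_synonym S3 = "3 perm"

text \<open>Sums over all of \<^typ>\<open>S3\<close> would be \<open>0\<close> were this type not known to be finite.\<close>

instance perm :: (finite) finite
proof
  have "inj (apply :: 'a perm \<Rightarrow> 'a \<Rightarrow> 'a)"
    by (rule injI) (simp add: apply_inject)
  then show "finite (UNIV :: 'a perm set)"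
    by (rule finite_imageD[rotated]) (rule finite)
qed

datatype transp = T12 | T13 | T23

primrec perm_of :: "transp \<Rightarrow> S3" where
  "perm_of T12 = Perm.swap 1 2"
| "perm_of T13 = Perm.swap 1 3"
| "perm_of T23 = Perm.swap 2 3"

definition conj_transp :: "S3 \<Rightarrow> transp \<Rightarrow> transp" where
  "conj_transp g t = (THE s. perm_of s = inverse g * perm_of t * g)"

lemma three_cases: "i = 1 \<or> i = 2 \<or> i = 3" for i :: 3
proof (induct i)
  case (of_int z)
  then have "z = 0 \<or> z = 1 \<or> z = 2" by fastforce
  then show ?case by auto
qed

lemma swap_eq_perm_of: "i \<noteq> j \<Longrightarrow> \<exists>s. Perm.swap i j = perm_of s" for i j :: 3
  using three_cases[of i] three_cases[of j] perm_of.simps swap_sym by metis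

lemma inj_perm_of: "inj perm_of"
proof (rule injI)
  fix s t assume "perm_of s = perm_of t"
  then have "apply (perm_of s) 1 = apply (perm_of t) 1" "apply (perm_of s) 2 = apply (perm_of t) 2"
    by simp_all
  then show "s = t"
    by (cases s; cases t) (simp_all add: swap.rep_eq transpose_def split: if_splits)
qed
lemma conj_perm_of: "\<exists>s. perm_of s = inverse g * perm_of t * g"
proof -
  obtain i j where ij: "perm_of t = Perm.swap i j" "i \<noteq> j"
  proof (cases t)
    case T12 then show ?thesis using that[of 1 2] by simp
  next
    case T13 then show ?thesis using that[of 1 3] by simp
  next
    case T23 then show ?thesis using that[of 2 3] by simp
  qed
  have "inverse g * Perm.swap i j * g = Perm.swap (apply (inverse g) i) (apply (inverse g) j)"
    by (rule perm_eqI)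
      (auto simp: apply_times swap.rep_eq transpose_def apply_inverse bij_inv_eq_iff[OF bij_apply] inv_f_f[OF bij_is_inj[OF bij_apply]] surj_f_inv_f[OF bij_is_surj[OF bij_apply]])
  then show ?thesis
    using ij swap_eq_perm_of[of "apply (inverse g) i" "apply (inverse g) j"]  by (metis apply_inj)
qed

lemma perm_of_conj_transp: "perm_of (conj_transp g t) = inverse g * perm_of t * g"
  unfolding conj_transp_def
  by (rule theI') (use conj_perm_of[of g t] inj_perm_of in \<open>metis injD\<close>)


section \<open>The algebra\<close>

definition parameters :: "(transp \<Rightarrow> 'k::field) set" where
  "parameters = {a. a T12 + a T13 + a T23 = 0}"

definition f_fun :: "(transp \<Rightarrow> 'k::field) \<Rightarrow> transp \<Rightarrow> S3 \<Rightarrow> 'k" where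
  "f_fun a t g = a t - a (conj_transp g t)"

datatype generator = Delta S3 | Trans transp

type_synonym 'k F = "(generator, 'k) free_algebra"

abbreviation \<delta>\<^sub>F :: "S3 \<Rightarrow> 'k::field F" where "\<delta>\<^sub>F g \<equiv> letter (Delta g)"

abbreviation x\<^sub>F :: "transp \<Rightarrow> 'k::field F" where "x\<^sub>F t \<equiv> letter (Trans t)"

definition fun_elem :: "(S3 \<Rightarrow> 'k::field) \<Rightarrow> 'k F" where
  "fun_elem u = (\<Sum>g\<in>UNIV. const (u g) * \<delta>\<^sub>F g)"

text \<open>
  The first two families of relations present the algebra of functions on \<^typ>\<open>S3\<close> by its basis
  of characteristic functions.
\<close>

definition relations :: "(transp \<Rightarrow> 'k::field) \<Rightarrow> 'k F set" where
  "relations a =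
     {\<delta>\<^sub>F g * \<delta>\<^sub>F h - (if g = h then \<delta>\<^sub>F g else 0) | g h. True} \<union>
     {(\<Sum>g\<in>UNIV. \<delta>\<^sub>F g) - 1} \<union>
     {\<delta>\<^sub>F h * x\<^sub>F t - x\<^sub>F t * \<delta>\<^sub>F (perm_of t * h) | h t. True} \<union>
     {x\<^sub>F t * x\<^sub>F t - fun_elem (f_fun a t) | t. True} \<union>
     {x\<^sub>F T13 * x\<^sub>F T23 + x\<^sub>F T23 * x\<^sub>F T12 + x\<^sub>F T12 * x\<^sub>F T13,
      x\<^sub>F T23 * x\<^sub>F T13 + x\<^sub>F T13 * x\<^sub>F T12 + x\<^sub>F T12 * x\<^sub>F T23}"

definition relation_ideal :: "(transp \<Rightarrow> 'k::field) \<Rightarrow> 'k F set" where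
  "relation_ideal a = Idl\<^bsub>ring_of_type_algebra\<^esub> (relations a)"

definition alg :: "(transp \<Rightarrow> 'k::field) \<Rightarrow> 'k F set ring" where
  "alg a = ring_of_type_algebra Quot relation_ideal a"

definition cls :: "(transp \<Rightarrow> 'k::field) \<Rightarrow> 'k F \<Rightarrow> 'k F set" where
  "cls a p = relation_ideal a +>\<^bsub>ring_of_type_algebra\<^esub> p"


section \<open>Modules over the algebra\<close>

definition scalars ::
    "(transp \<Rightarrow> 'k::field) \<Rightarrow> ('k F set, 'm, 'd) module_scheme \<Rightarrow> ('k, 'm) module" where
  "scalars a M = restrict_scalars (cls a \<circ> const) M"

definition linear_span ::
    "(transp \<Rightarrow> 'k::field) \<Rightarrow> ('k F set, 'm, 'd) module_scheme \<Rightarrow> 'm set \<Rightarrow> 'm set" where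
  "linear_span a M S = generated_submodule ring_of_type_algebra (scalars a M) S"

definition weight_space ::
    "(transp \<Rightarrow> 'k::field) \<Rightarrow> ('k F set, 'm, 'd) module_scheme \<Rightarrow> S3 \<Rightarrow> 'm set" where
  "weight_space a M g = (\<lambda>m. cls a (\<delta>\<^sub>F g) \<odot>\<^bsub>M\<^esub> m) ` carrier M"

definition function_ring :: "(S3 \<Rightarrow> 'k::field) ring" where
  "function_ring =
     \<lparr>carrier = UNIV, monoid.mult = (\<lambda>u v g. u g * v g), one = (\<lambda>g. 1),
      ring.zero = (\<lambda>g. 0), add = (\<lambda>u v g. u g + v g)\<rparr>"

definition point_module :: "S3 \<Rightarrow> (S3 \<Rightarrow> 'k::field, 'k) module" where
  "point_module g =
     \<lparr>carrier = UNIV, monoid.mult = undefined, one = undefined,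
      ring.zero = 0, add = (+), module.smult = (\<lambda>u c. u g * c)\<rparr>"

definition verma ::
    "(transp \<Rightarrow> 'k::field) \<Rightarrow> S3 \<Rightarrow> ('k F set, (('k F set \<times> 'k) \<Rightarrow>\<^sub>0 int) set) module" where
  "verma a g = tensor_module (alg a) function_ring (cls a \<circ> fun_elem) (point_module g)"

definition verma_vec ::
    "(transp \<Rightarrow> 'k::field) \<Rightarrow> S3 \<Rightarrow> transp list \<Rightarrow> (('k F set \<times> 'k) \<Rightarrow>\<^sub>0 int) set" where
  "verma_vec a g ts =
     pure_tensor (alg a) function_ring (cls a \<circ> fun_elem) (point_module g)
       (cls a (prod_list (map x\<^sub>F ts))) 1"

primrec simple_char :: "S3 \<Rightarrow> generator \<Rightarrow> 'k::field" where
  "simple_char h (Delta g) = (if g = h then 1 else 0)"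
| "simple_char h (Trans t) = 0"

text \<open>
  A coset of the relation ideal acts through the value of \<open>eval (simple_char h)\<close> on it. This value is
  unique exactly when the character kills the relations, i.e. when \<open>f_fun a t h = 0\<close> for all \<open>t\<close>.
\<close>

definition simple_module :: "S3 \<Rightarrow> ('k::field F set, 'k) module" where
  "simple_module h =
     \<lparr>carrier = UNIV, monoid.mult = undefined, one = undefined,
      ring.zero = 0, add = (+),
      module.smult = (\<lambda>C c. the_elem (eval (simple_char h) ` C) * c)\<rparr>"


section \<open>The Verma module at \<open>(13)(23)\<close>\<close>

definition Ver :: "(transp \<Rightarrow> 'k::field) \<Rightarrow> ('k F set, (('k F set \<times> 'k) \<Rightarrow>\<^sub>0 int) set) module" where
  "Ver a = verma a (perm_of T13 * perm_of T23)"

definition mvec :: "(transp \<Rightarrow> 'k::field) \<Rightarrow> transp list \<Rightarrow> (('k F set \<times> 'k) \<Rightarrow>\<^sub>0 int) set" where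
  "mvec a ts = verma_vec a (perm_of T13 * perm_of T23) ts"

definition subm ::
    "(transp \<Rightarrow> 'k::field) \<Rightarrow> (('k F set \<times> 'k) \<Rightarrow>\<^sub>0 int) set set \<Rightarrow> (('k F set \<times> 'k) \<Rightarrow>\<^sub>0 int) set set" where
  "subm a U = generated_submodule (alg a) (Ver a) U"

definition span_Ver ::
    "(transp \<Rightarrow> 'k::field) \<Rightarrow> (('k F set \<times> 'k) \<Rightarrow>\<^sub>0 int) set set \<Rightarrow> (('k F set \<times> 'k) \<Rightarrow>\<^sub>0 int) set set" where
  "span_Ver a U = linear_span a (Ver a) U"

definition Ver_wt :: "(transp \<Rightarrow> 'k::field) \<Rightarrow> S3 \<Rightarrow> (('k F set \<times> 'k) \<Rightarrow>\<^sub>0 int) set set" where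
  "Ver_wt a g = weight_space a (Ver a) g"

definition m_top :: "(transp \<Rightarrow> 'k::field) \<Rightarrow> (('k F set \<times> 'k) \<Rightarrow>\<^sub>0 int) set" where
  "m_top a = mvec a [T13, T12, T23, T12]"

definition m_soc :: "(transp \<Rightarrow> 'k::field) \<Rightarrow> (('k F set \<times> 'k) \<Rightarrow>\<^sub>0 int) set" where
  "m_soc a =
     (f_fun a T13 (perm_of T23) * f_fun a T23 (perm_of T13)) \<odot>\<^bsub>scalars a (Ver a)\<^esub> mvec a [] \<ominus>\<^bsub>Ver a\<^esub> m_top a"

definition m_o :: "(transp \<Rightarrow> 'k::field) \<Rightarrow> (('k F set \<times> 'k) \<Rightarrow>\<^sub>0 int) set" where
  "m_o a = mvec a [T13, T12, T13] \<oplus>\<^bsub>Ver a\<^esub> f_fun a T13 (perm_of T23) \<odot>\<^bsub>scalars a (Ver a)\<^esub> mvec a [T23]"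

definition N_1323 :: "(transp \<Rightarrow> 'k::field) \<Rightarrow> (('k F set \<times> 'k) \<Rightarrow>\<^sub>0 int) set set" where
  "N_1323 a = subm a (Ver_wt a 1 <+>\<^bsub>Ver a\<^esub> Ver_wt a (perm_of T12))"

definition v_set :: "(transp \<Rightarrow> 'k::field) \<Rightarrow> (('k F set \<times> 'k) \<Rightarrow>\<^sub>0 int) set set" where
  "v_set a = {v \<in> Ver_wt a 1. Ver_wt a 1 = span_Ver a {v, mvec a [T12, T23]}}"

definition w_set :: "(transp \<Rightarrow> 'k::field) \<Rightarrow> (('k F set \<times> 'k) \<Rightarrow>\<^sub>0 int) set set" where
  "w_set a = {w \<in> Ver_wt a (perm_of T12). Ver_wt a (perm_of T12) = span_Ver a {w, m_o a}}"


section \<open>Covering relation of a family of sets\<close>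

definition covers :: "'m set set \<Rightarrow> ('m set \<times> 'm set) set" where
  "covers L = {(U, V). U \<in> L \<and> V \<in> L \<and> V \<subset> U \<and> \<not> (\<exists>W\<in>L. V \<subset> W \<and> W \<subset> U)}"

end

theory Submission
  imports Defs "HOL-Library.Product_Plus"
begin

text \<open>
  The relations of the algebra allow every product of the \<open>x\<^sub>i\<^sub>j\<close> applied to \<open>m\<^sub>1\<close> to be rewritten into
  twelve explicit vectors, and the resulting multiplication table satisfies all relations, so it is a
  model of the Verma module. The basis is chosen so that it is adapted to the submodules: \<open>x\<^sub>1\<^sub>2\<close>,
  \<open>x\<^sub>1\<^sub>3\<close>, \<open>x\<^sub>2\<^sub>3\<close> permute the weights \<open>(13)(23)\<close>, \<open>(13)\<close>, \<open>(23)\<close>, \<open>(23)(13)\<close> with nonzero coefficients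
  along a square. Hence every nonzero submodule contains the socle, and a submodule with a vector outside
  \<open>N\<^bsub>(13)(23)\<^esub>\<close> is everything. The remaining submodules correspond to pairs of subspaces \<open>E \<subseteq> M[e]\<close>
  and \<open>W \<subseteq> M[(12)]\<close> of these planes with \<open>x\<^sub>1\<^sub>2 E \<subseteq> W\<close> and \<open>x\<^sub>1\<^sub>2 W \<subseteq> E\<close>, where \<open>x\<^sub>1\<^sub>2\<close> has rank one in
  both directions.
\<close>

subsection \<open>Free algebras\<close>

text \<open>The tensor product is a quotient of a free abelian group, which gives no control over
  its dimension. Rewriting only shows that the chosen vectors span. Their independence comes from a
  map in the other direction: any representation of the free algebra that kills
  \<open>relations a\<close>, together with a vector of weight g, receives a map from the Verma
  module (\<open>tens_eq_imp\<close>), and the multiplication table is such a representation.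

  Only one parameter survives. When a_(13) = a_(23), every value f_ij(g) is 0, b or -b, where b =
  a_(13) - a_(12) is nonzero.

  The vector m_o measures the failure of the braid relation: x12 x13 x12 m_1 = x13 x12 x13 m_1 + b
  x23 m_1, and the right-hand side is m_o. With m_o as a basis vector, x12 sends x13 x12 m_1 to m_o
  and x23 m_1 to x12 x23 m_1, and it kills m_o and x12 x23 m_1. The generators x13 and x23 carry
  both planes into the socle, so only x12 constrains the pair (E, W).\<close>

lemma poly_mapping_induct_single [case_names single add]:
  fixes p :: "'a \<Rightarrow>\<^sub>0 'b::comm_monoid_add"
  assumes single: "\<And>k c. P (Poly_Mapping.single k c)"
    and add: "\<And>p q. P p \<Longrightarrow> P q \<Longrightarrow> P (p + q)"
  shows "P p"
proof (induction p rule: update_induct)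
  case const
  \<comment> \<open>Zero is a \<open>single\<close> with coefficient 0, at an arbitrary key.\<close>
  show ?case using single[of undefined 0] by simp
next
  case (update f k c)
  then have "Poly_Mapping.update k c f = f + Poly_Mapping.single k c"
    by (intro poly_mapping_eqI)
      (auto simp: lookup_update lookup_add lookup_single when_def in_keys_iff)
  with update add single show ?case by metis
qed

lemma single_Word_Cons:
  "Poly_Mapping.single (Word (s # l)) c = letter s * Poly_Mapping.single (Word l) c"
  by (simp add: letter_def mult_single plus_word_def)

text \<open>Words grow on the left, by the letter that acts last on a left module, so a property of
  an action is checked on single letters only.\<close>

lemma free_algebra_induct [case_names const letter add]:
  fixes p :: "('g, 'k::comm_ring_1) free_algebra"
  assumes const: "\<And>c. P (const c)"
    and letter: "\<And>s p. P p \<Longrightarrow> P (letter s * p)"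
    and add: "\<And>p q. P p \<Longrightarrow> P q \<Longrightarrow> P (p + q)"
  shows "P p"
proof (induction p rule: poly_mapping_induct_single)
  case (single k c)
  have "P (Poly_Mapping.single (Word l) c)" for l
  proof (induction l)
    case Nil
    then show ?case using const[of c] by (simp add: const_def zero_word_def)
  next
    case (Cons s l)
    then show ?case by (simp add: single_Word_Cons letter)
  qed
  then show ?case by (cases k) simp
next
  case (add p q)
  then show ?case by (rule assms(3))
qed

lemma const_hom:
  "const 0 = 0" "const 1 = 1" "const (c + d) = const c + const d"
  "const (c * d) = const c * const d" "const (- c) = - const c"
  "const (c - d) = const c - const d"
  by (simp_all add: const_def single_add mult_single single_uminus single_diff)

lemma const_commute: "p * const c = const c * p"
proof (induction p rule: poly_mapping_induct_single)
  case (single k d)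
  then show ?case by (simp add: const_def mult_single mult.commute)
qed (simp add: algebra_simps)

lemma const_left_commute: "p * (const c * q) = const c * (p * q)"
  by (metis const_commute mult.assoc)

text \<open>\<open>foldr\<close> lets the last letter of a word act first, which makes concatenation
  of words act as composition.\<close>

definition word_action :: "('k \<Rightarrow> 'b \<Rightarrow> 'b) \<Rightarrow> ('g \<Rightarrow> 'b \<Rightarrow> 'b) \<Rightarrow>
    ('g, 'k::comm_ring_1) free_algebra \<Rightarrow> 'b \<Rightarrow> 'b::ab_group_add" where
  "word_action sc A p v =
     (\<Sum>w\<in>Poly_Mapping.keys p. sc (Poly_Mapping.lookup p w) (foldr A (letters w) v))"

locale letter_action =
  fixes sc :: "'k::comm_ring_1 \<Rightarrow> 'b \<Rightarrow> 'b::ab_group_add" and A :: "'g \<Rightarrow> 'b \<Rightarrow> 'b"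
  assumes sc_add_left: "sc (c + d) v = sc c v + sc d v"
    and sc_add_right: "sc c (v + w) = sc c v + sc c w"
    and sc_sc: "sc c (sc d v) = sc (c * d) v"
    and sc_one: "sc 1 v = v"
    and A_add: "A s (v + w) = A s v + A s w"
    and A_sc: "A s (sc c v) = sc c (A s v)"
begin

abbreviation "\<rho> \<equiv> word_action sc A"

lemma sc_zero_left: "sc 0 v = 0"
  using sc_add_left[of 0 0 v] by simp

lemma action_add: "\<rho> (p + q) v = \<rho> p v + \<rho> q v"
  unfolding word_action_def
  by (rule setsum_keys_plus_distrib) (simp_all add: sc_zero_left sc_add_left)

lemma action_single: "\<rho> (Poly_Mapping.single w c) v = sc c (foldr A (letters w) v)"
  by (cases "c = 0") (simp_all add: word_action_def sc_zero_left)

lemma action_const: "\<rho> (const c) v = sc c v"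
  by (simp add: const_def action_single zero_word_def)

lemma action_letter: "\<rho> (letter s) v = A s v"
  by (simp add: letter_def action_single sc_one)

lemma action_zero: "\<rho> 0 v = 0"
  by (simp add: word_action_def)

lemma action_one: "\<rho> 1 v = v"
  using action_const[of 1 v] by (simp add: const_hom sc_one)

lemma foldr_sc: "foldr A l (sc c v) = sc c (foldr A l v)"
  by (induction l) (simp_all add: A_sc)

lemma foldr_add: "foldr A l (v + w) = foldr A l v + foldr A l w"
  by (induction l) (simp_all add: A_add)

lemma action_add_right: "\<rho> p (v + w) = \<rho> p v + \<rho> p w"
  by (simp add: word_action_def foldr_add sc_add_right sum.distrib)

lemma action_mult: "\<rho> (p * q) v = \<rho> p (\<rho> q v)"
proof (induction p rule: poly_mapping_induct_single)
  case (single k c)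
  show ?case
  proof (induction q rule: poly_mapping_induct_single)
    case (single l d)
    then show ?case
      by (simp add: mult_single action_single plus_word_def foldr_sc sc_sc)
  qed (simp add: distrib_left action_add action_add_right)
qed (simp add: distrib_right action_add)

lemma action_zero_right: "\<rho> p 0 = 0"
  using action_add_right[of p 0 0] by simp

lemma action_uminus: "\<rho> (- p) v = - \<rho> p v"
  using action_add[of p "- p" v] by (simp add: action_zero eq_neg_iff_add_eq_0 add.commute)

lemma action_diff: "\<rho> (p - q) v = \<rho> p v - \<rho> q v"
  using action_add[of p "- q" v] by (simp add: action_uminus)

lemma action_sum: "\<rho> (\<Sum>i\<in>I. f i) v = (\<Sum>i\<in>I. \<rho> (f i) v)"
  by (induction I rule: infinite_finite_induct) (simp_all add: action_add action_zero)

lemmas action_simps = action_add action_mult action_diff action_uminus action_sum action_const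
  action_letter action_zero action_one

end

lemma letter_action_mult: "letter_action (*) (\<lambda>s. (*) (\<phi> s :: 'k::comm_ring_1))"
  by standard (simp_all add: algebra_simps)

text \<open>A character is a one-dimensional representation, so \<open>eval\<close> inherits the
  laws of \<open>word_action\<close>.\<close>

lemma eval_eq_word_action: "eval \<phi> p = word_action (*) (\<lambda>s. (*) (\<phi> s)) p 1"
proof -
  have "foldr (\<lambda>s. (*) (\<phi> s)) l 1 = prod_list (map \<phi> l)" for l
    by (induction l) simp_all
  then show ?thesis by (simp add: eval_def word_action_def)
qed

subsection \<open>The symmetric group\<close>

text \<open>The images of 1 and 2 leave only one place for the third letter. The criterion turns
  equations in the group into evaluations.\<close>

lemma S3_eq_iff: "g = h \<longleftrightarrow> apply g 1 = apply h 1 \<and> apply g 2 = apply h 2" for g h :: S3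
proof (intro iffI perm_eqI)
  fix i :: 3
  assume eq: "apply g 1 = apply h 1 \<and> apply g 2 = apply h 2"
  have "apply g 3 = apply h 3"
  proof (rule ccontr)
    assume ne: "apply g 3 \<noteq> apply h 3"
    have "apply g 1 \<noteq> apply g 2" "apply g 1 \<noteq> apply g 3" "apply g 2 \<noteq> apply g 3"
      "apply h 1 \<noteq> apply h 3" "apply h 2 \<noteq> apply h 3"
      by (simp_all add: apply_inj)
    with eq ne show False
      using three_cases[of "apply g 1"] three_cases[of "apply g 2"] three_cases[of "apply g 3"]
        three_cases[of "apply h 3"] by metis
  qed
  with eq show "apply g i = apply h i" using three_cases[of i] by auto
qed simp

abbreviation (input) g12 :: S3 where "g12 \<equiv> perm_of T12"
abbreviation (input) g13 :: S3 where "g13 \<equiv> perm_of T13"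
abbreviation (input) g23 :: S3 where "g23 \<equiv> perm_of T23"

definition rot :: S3 where "rot = g13 * g23"
definition rot' :: S3 where "rot' = g23 * g13"

lemmas S3_eval = S3_eq_iff apply_times swap.rep_eq transpose_def rot_def rot'_def

lemma S3_distinct: "distinct [1, g12, g13, g23, rot, rot']"
  by (simp add: S3_eval)

lemma S3_mult:
  "g12 * g12 = 1" "g12 * g13 = rot" "g12 * g23 = rot'" "g12 * rot = g13" "g12 * rot' = g23"
  "g13 * g12 = rot'" "g13 * g13 = 1" "g13 * g23 = rot" "g13 * rot = g23" "g13 * rot' = g12"
  "g23 * g12 = rot" "g23 * g13 = rot'" "g23 * g23 = 1" "g23 * rot = g12" "g23 * rot' = g13"
  "rot * g12 = g23" "rot * g13 = g12" "rot * g23 = g13"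
  "rot' * g12 = g13" "rot' * g13 = g23" "rot' * g23 = g12"
  by (simp_all add: S3_eval)

lemma S3_cases: "g \<in> {1, g12, g13, g23, rot, rot'}"
proof -
  have "apply g 1 \<noteq> apply g 2" by (simp add: apply_inj)
  then show ?thesis
    using three_cases[of "apply g 1"] three_cases[of "apply g 2"] by (auto simp: S3_eval)
qed

lemma S3_UNIV: "(UNIV :: S3 set) = {1, g12, g13, g23, rot, rot'}"
  using S3_cases by blast

lemma conj_transp_eqI: "perm_of t * g = g * perm_of s \<Longrightarrow> conj_transp g t = s"
  by (rule injD[OF inj_perm_of]) (simp add: perm_of_conj_transp mult.assoc mult.assoc[of "inverse g" g, symmetric])

lemma conj_transp_table:
  "conj_transp 1 t = t"
  "conj_transp g12 T12 = T12" "conj_transp g12 T13 = T23" "conj_transp g12 T23 = T13"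
  "conj_transp g13 T12 = T23" "conj_transp g13 T13 = T13" "conj_transp g13 T23 = T12"
  "conj_transp g23 T12 = T13" "conj_transp g23 T13 = T12" "conj_transp g23 T23 = T23"
  "conj_transp rot T12 = T23" "conj_transp rot T13 = T12" "conj_transp rot T23 = T13"
  "conj_transp rot' T12 = T13" "conj_transp rot' T13 = T23" "conj_transp rot' T23 = T12"
  by (rule conj_transp_eqI, simp add: S3_mult del: perm_of.simps)+

subsection \<open>The algebra\<close>

lemma ring_of_type_algebra_simps:
  "carrier ring_of_type_algebra = UNIV"
  "x \<otimes>\<^bsub>ring_of_type_algebra\<^esub> y = x * y"
  "x \<oplus>\<^bsub>ring_of_type_algebra\<^esub> y = x + y"
  "\<one>\<^bsub>ring_of_type_algebra\<^esub> = (1 :: 'a)"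
  "\<zero>\<^bsub>ring_of_type_algebra\<^esub> = (0 :: 'a)" for x y :: "'a::ring_1"
  by (simp_all add: ring_of_type_algebra_def)

lemma ring_ring_of_type_algebra: "ring (ring_of_type_algebra :: 'a::ring_1 ring)"
proof -
  have "\<exists>y. x + y = 0 \<and> y + x = 0" for x :: 'a
    by (rule exI[of _ "- x"]) simp
  then show ?thesis
    by unfold_locales
      (auto simp: ring_of_type_algebra_def algebra_simps Units_def)
qed

lemma ideal_relation_ideal: "ideal (relation_ideal a) ring_of_type_algebra"
  unfolding relation_ideal_def
  by (rule ring.genideal_ideal[OF ring_ring_of_type_algebra]) (simp add: ring_of_type_algebra_simps)

lemma relations_subset_ideal: "relations a \<subseteq> relation_ideal a"
  unfolding relation_ideal_def
  by (rule ring.genideal_self[OF ring_ring_of_type_algebra]) (simp add: ring_of_type_algebra_simps)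

lemma a_inv_ring_of_type_algebra: "\<ominus>\<^bsub>ring_of_type_algebra\<^esub> x = - (x :: 'a::ring_1)"
proof -
  interpret ring "ring_of_type_algebra :: 'a ring" by (rule ring_ring_of_type_algebra)
  show ?thesis
    by (rule minus_equality) (simp_all add: ring_of_type_algebra_simps)
qed

lemma relation_ideal_closed:
  "0 \<in> relation_ideal a"
  "p \<in> relation_ideal a \<Longrightarrow> q \<in> relation_ideal a \<Longrightarrow> p + q \<in> relation_ideal a"
  "p \<in> relation_ideal a \<Longrightarrow> - p \<in> relation_ideal a"
  "p \<in> relation_ideal a \<Longrightarrow> q * p \<in> relation_ideal a"
  "p \<in> relation_ideal a \<Longrightarrow> p * q \<in> relation_ideal a"
proof -
  interpret ideal "relation_ideal a" ring_of_type_algebra by (rule ideal_relation_ideal)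
  show "0 \<in> relation_ideal a"
    using additive_subgroup.zero_closed[OF is_additive_subgroup] by (simp add: ring_of_type_algebra_simps)
  show "p \<in> relation_ideal a \<Longrightarrow> q \<in> relation_ideal a \<Longrightarrow> p + q \<in> relation_ideal a"
    using additive_subgroup.a_closed[OF is_additive_subgroup, of p q] by (simp add: ring_of_type_algebra_simps)
  show "p \<in> relation_ideal a \<Longrightarrow> - p \<in> relation_ideal a"
    using additive_subgroup.a_inv_closed[OF is_additive_subgroup, of p] by (simp add: a_inv_ring_of_type_algebra)
  show "p \<in> relation_ideal a \<Longrightarrow> q * p \<in> relation_ideal a"
    using I_l_closed[of p q] by (simp add: ring_of_type_algebra_simps)
  show "p \<in> relation_ideal a \<Longrightarrow> p * q \<in> relation_ideal a"
    using I_r_closed[of p q] by (simp add: ring_of_type_algebra_simps)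
qed

lemma relation_ideal_subset:
  assumes "relations a \<subseteq> I" "0 \<in> I" "\<And>p q. p \<in> I \<Longrightarrow> q \<in> I \<Longrightarrow> p + q \<in> I"
    and "\<And>p q. p \<in> I \<Longrightarrow> q * p \<in> I" "\<And>p q. p \<in> I \<Longrightarrow> p * q \<in> I"
  shows "relation_ideal a \<subseteq> I"
proof -
  have "subgroup I (add_monoid ring_of_type_algebra)"
  proof
    fix p assume "p \<in> I"
    \<comment> \<open>Negation is multiplication by -1, so closure under left multiples already
      gives an additive subgroup.\<close>
    then have "- p \<in> I" using assms(4)[of p "-1"] by simp
    then show "inv\<^bsub>add_monoid ring_of_type_algebra\<^esub> p \<in> I"
      using a_inv_ring_of_type_algebra[of p] unfolding a_inv_def by simp
  qed (simp_all add: ring_of_type_algebra_simps assms)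
  then have "ideal I ring_of_type_algebra"
    by (intro idealI ring_ring_of_type_algebra) (simp_all add: ring_of_type_algebra_simps assms)
  then show ?thesis
    unfolding relation_ideal_def
    by (intro ring.genideal_minimal[OF ring_ring_of_type_algebra] assms(1))
qed

text \<open>The annihilator of the whole module is a two-sided ideal: p * q kills v because p kills
  the image of v under q. The annihilator of a single vector would only be a left ideal, hence the
  quantification over all v.\<close>

lemma word_action_relation_ideal:
  assumes "letter_action sc A" and "\<And>p v. p \<in> relations a \<Longrightarrow> word_action sc A p v = 0"
    and "p \<in> relation_ideal a"
  shows "word_action sc A p v = 0"
proof -
  interpret letter_action sc A by fact
  have "relation_ideal a \<subseteq> {p. \<forall>v. \<rho> p v = 0}"
    by (rule relation_ideal_subset) (simp_all add: assms(2) subset_iff action_simps action_zero_right)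
  with assms(3) show ?thesis by blast
qed

lemma carrier_alg: "carrier (alg a) = range (cls a)"
  by (auto simp: alg_def cls_def FactRing_def A_RCOSETS_def' ring_of_type_algebra_simps)

lemma
  shows alg_add: "cls a p \<oplus>\<^bsub>alg a\<^esub> cls a q = cls a (p + q)"
    and alg_mult: "cls a p \<otimes>\<^bsub>alg a\<^esub> cls a q = cls a (p * q)"
proof -
  interpret ideal "relation_ideal a" ring_of_type_algebra by (rule ideal_relation_ideal)
  show "cls a p \<oplus>\<^bsub>alg a\<^esub> cls a q = cls a (p + q)"
    using ring_hom_add[OF rcos_ring_hom, of p q] by (simp add: cls_def alg_def ring_of_type_algebra_simps)
  show "cls a p \<otimes>\<^bsub>alg a\<^esub> cls a q = cls a (p * q)"
    using ring_hom_mult[OF rcos_ring_hom, of p q] by (simp add: cls_def alg_def ring_of_type_algebra_simps)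
qed

lemma cls_eq: "cls a p = (\<lambda>r. r + p) ` relation_ideal a"
  by (auto simp: cls_def a_r_coset_defs ring_of_type_algebra_def)

lemma cls_eq_iff: "cls a p = cls a q \<longleftrightarrow> p - q \<in> relation_ideal a"
proof
  assume "cls a p = cls a q"
  moreover have "p \<in> cls a p" using relation_ideal_closed(1) by (force simp: cls_eq)
  ultimately show "p - q \<in> relation_ideal a" by (auto simp: cls_eq)
next
  assume pq: "p - q \<in> relation_ideal a"
  have sub: "cls a p \<subseteq> cls a q" if pq: "p - q \<in> relation_ideal a" for p q
  proof
    fix x assume "x \<in> cls a p"
    then obtain r where "r \<in> relation_ideal a" "x = r + p" by (auto simp: cls_eq)
    then have "x = (r + (p - q)) + q" "r + (p - q) \<in> relation_ideal a"
      using relation_ideal_closed(2) pq by auto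
    then show "x \<in> cls a q" unfolding cls_eq by blast
  qed
  from sub[OF pq] sub[of q p] relation_ideal_closed(3)[OF pq] show "cls a p = cls a q" by auto
qed

subsection \<open>Verma modules\<close>

lemma a_r_coset_image: "add M = (+) \<Longrightarrow> K +>\<^bsub>M\<^esub> P = (\<lambda>k. k + P) ` K"
  by (auto simp: a_r_coset_defs)

lemma add_coset_eq_iff:
  fixes K :: "'a::ab_group_add set"
  assumes "0 \<in> K" "\<And>k l. k \<in> K \<Longrightarrow> l \<in> K \<Longrightarrow> k - l \<in> K"
  shows "(\<lambda>k. k + P) ` K = (\<lambda>k. k + Q) ` K \<longleftrightarrow> P - Q \<in> K"
proof
  assume "(\<lambda>k. k + P) ` K = (\<lambda>k. k + Q) ` K"
  moreover have "P \<in> (\<lambda>k. k + P) ` K" using assms(1) by force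
  ultimately show "P - Q \<in> K" by auto
next
  have neg: "- k \<in> K" if "k \<in> K" for k using assms(2)[OF assms(1) that] by simp
  have add: "k + l \<in> K" if "k \<in> K" "l \<in> K" for k l
    using assms(2)[OF that(1) neg[OF that(2)]] by simp
  have sub: "(\<lambda>k. k + P) ` K \<subseteq> (\<lambda>k. k + Q) ` K" if PQ: "P - Q \<in> K" for P Q
  proof
    fix x assume "x \<in> (\<lambda>k. k + P) ` K"
    then obtain k where "k \<in> K" "x = k + P" by blast
    then have "x = (k + (P - Q)) + Q" "k + (P - Q) \<in> K" using add PQ by auto
    then show "x \<in> (\<lambda>k. k + Q) ` K" by blast
  qed
  assume PQ: "P - Q \<in> K"
  from sub[OF PQ] sub[of Q P] neg[OF PQ] show "(\<lambda>k. k + P) ` K = (\<lambda>k. k + Q) ` K" by auto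
qed

locale verma_module =
  fixes a :: "transp \<Rightarrow> 'k::field" and g :: S3
begin

abbreviation "FP \<equiv> free_pairs (alg a) (point_module g)"
definition "K = tensor_kernel (alg a) function_ring (cls a \<circ> fun_elem) (point_module g)"
definition "Rel = tensor_relations (alg a) function_ring (cls a \<circ> fun_elem) (point_module g)"

lemma FP_simps:
  "carrier FP = {P. Poly_Mapping.keys P \<subseteq> range (cls a) \<times> UNIV}"
  "P \<oplus>\<^bsub>FP\<^esub> Q = P + Q" "\<zero>\<^bsub>FP\<^esub> = 0" "add FP = (+)"
  "r \<odot>\<^bsub>FP\<^esub> P = frag_extend (\<lambda>(s, n). frag_of (r \<otimes>\<^bsub>alg a\<^esub> s, n)) P"
  by (simp_all add: free_pairs_def carrier_alg point_module_def)

lemma group_FP: "group (add_monoid FP)"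
proof (rule groupI)
  fix P assume "P \<in> carrier (add_monoid FP)"
  then show "\<exists>Q\<in>carrier (add_monoid FP). Q \<otimes>\<^bsub>add_monoid FP\<^esub> P = \<one>\<^bsub>add_monoid FP\<^esub>"
    by (intro bexI[of _ "- P"]) (simp_all add: FP_simps)
qed (use keys_add in \<open>fastforce simp: FP_simps add.assoc\<close>)+

lemma inv_FP: "P \<in> carrier FP \<Longrightarrow> inv\<^bsub>add_monoid FP\<^esub> P = - P"
  by (rule group.inv_equality[OF group_FP]) (simp_all add: FP_simps)

lemma carrier_FP_closed:
  "P \<in> carrier FP \<Longrightarrow> Q \<in> carrier FP \<Longrightarrow> P + Q \<in> carrier FP"
  "P \<in> carrier FP \<Longrightarrow> Q \<in> carrier FP \<Longrightarrow> P - Q \<in> carrier FP"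
  "frag_of (cls a p, c) \<in> carrier FP"
  using keys_add[of P Q] keys_diff[of P Q] by (fastforce simp: FP_simps)+

lemma Rel_cases [consumes 1, case_names add_left add_right balanced]:
  assumes "P \<in> Rel"
  obtains p q c where "P = frag_of (cls a (p + q), c) - frag_of (cls a p, c) - frag_of (cls a q, c)"
  | p c d where "P = frag_of (cls a p, c + d) - frag_of (cls a p, c) - frag_of (cls a p, d)"
  | p u c where "P = frag_of (cls a (p * fun_elem u), c) - frag_of (cls a p, u g * c)"
  using assms
  by (auto simp: Rel_def tensor_relations_def carrier_alg point_module_def function_ring_def alg_add alg_mult)

lemma Rel_subset: "Rel \<subseteq> carrier FP"
  by (auto elim!: Rel_cases intro!: carrier_FP_closed)

lemma Rel_memI:
  "frag_of (cls a (p + q), c) - frag_of (cls a p, c) - frag_of (cls a q, c) \<in> Rel"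
  "frag_of (cls a (p * fun_elem u), c) - frag_of (cls a p, u g * c) \<in> Rel"
  "frag_of (cls a p, c + d) - frag_of (cls a p, c) - frag_of (cls a p, d) \<in> Rel"
proof -
  show "frag_of (cls a (p + q), c) - frag_of (cls a p, c) - frag_of (cls a q, c) \<in> Rel"
    unfolding Rel_def tensor_relations_def alg_add[symmetric]
    by (intro UnI1 CollectI exI conjI refl) (auto simp: carrier_alg point_module_def)
  show "frag_of (cls a (p * fun_elem u), c) - frag_of (cls a p, u g * c) \<in> Rel"
    unfolding Rel_def tensor_relations_def
    by (intro UnI2 CollectI exI[of _ "cls a p"] exI[of _ u] exI[of _ c] conjI)
      (simp_all add: carrier_alg point_module_def function_ring_def alg_mult)
  show "frag_of (cls a p, c + d) - frag_of (cls a p, c) - frag_of (cls a p, d) \<in> Rel"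
    unfolding Rel_def tensor_relations_def
    by (rule UnI1, rule UnI2, intro CollectI exI[of _ "cls a p"] exI[of _ c] exI[of _ d] conjI)
      (simp_all add: carrier_alg point_module_def)
qed

lemma subgroup_K: "subgroup K (add_monoid FP)"
  unfolding K_def tensor_kernel_def Rel_def[symmetric]
  by (rule group.generate_is_subgroup[OF group_FP]) (use Rel_subset in simp)

lemma
  shows K_zero: "0 \<in> K" and K_add: "\<And>k l. k \<in> K \<Longrightarrow> l \<in> K \<Longrightarrow> k + l \<in> K"
    and K_diff: "\<And>k l. k \<in> K \<Longrightarrow> l \<in> K \<Longrightarrow> k - l \<in> K"
    and K_Rel: "\<And>k. k \<in> Rel \<Longrightarrow> k \<in> K"
proof -
  show zero: "0 \<in> K" using subgroup.one_closed[OF subgroup_K] by (simp add: FP_simps)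
  show add: "k + l \<in> K" if "k \<in> K" "l \<in> K" for k l
    using subgroup.m_closed[OF subgroup_K that] by (simp add: FP_simps)
  have carr: "k \<in> carrier FP" if "k \<in> K" for k
    using subgroup.mem_carrier[OF subgroup_K that] by simp
  have neg: "- k \<in> K" if "k \<in> K" for k
    using subgroup.m_inv_closed[OF subgroup_K that] carr[OF that] by (simp add: inv_FP)
  show "k - l \<in> K" if "k \<in> K" "l \<in> K" for k l
    using add[OF that(1) neg[OF that(2)]] by simp
  show "k \<in> K" if "k \<in> Rel" for k
    unfolding K_def tensor_kernel_def Rel_def[symmetric] using that by (rule generate.incl)
qed

lemma K_induct [consumes 1, case_names zero Rel add uminus]:
  assumes "k \<in> K" and zero: "P 0" and Rel: "\<And>r. r \<in> Rel \<Longrightarrow> P r"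
    and add: "\<And>k l. P k \<Longrightarrow> P l \<Longrightarrow> P (k + l)" and uminus: "\<And>k. P k \<Longrightarrow> P (- k)"
  shows "P k"
  using assms(1) unfolding K_def tensor_kernel_def Rel_def[symmetric]
proof (induction rule: generate.induct)
  case (inv h)
  then show ?case using Rel_subset inv_FP[of h] Rel[of h] uminus[of h] by auto
qed (simp_all add: FP_simps zero Rel add)

text \<open>Left multiplication by q commutes with addition in the first factor and with right
  multiplication by functions, so it sends each tensor relation to one of the same kind. This makes
  the action on cosets well defined.\<close>

lemma frag_scale_K:
  assumes "k \<in> K"
  shows "cls a q \<odot>\<^bsub>FP\<^esub> k \<in> K"
  using assms
proof (induction rule: K_induct)
  case (Rel r)
  then show ?case
  proof (cases rule: Rel_cases)
    case (add_left p p' c)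
    then show ?thesis
      using Rel_memI(1)[of "q * p" "q * p'" c]
      by (intro K_Rel) (simp add: FP_simps frag_extend_diff alg_mult distrib_left)
  next
    case (add_right p c d)
    then show ?thesis
      using Rel_memI(3)[of "q * p" c d]
      by (intro K_Rel) (simp add: FP_simps frag_extend_diff alg_mult)
  next
    case (balanced p u c)
    then show ?thesis
      using Rel_memI(2)[of "q * p" u c]
      by (intro K_Rel) (simp add: FP_simps frag_extend_diff alg_mult mult.assoc)
  qed
next
  case (uminus k)
  then show ?case using K_diff[OF K_zero] by (simp add: FP_simps frag_extend_minus)
qed (simp_all add: FP_simps K_zero K_add frag_extend_add)

text \<open>By \<open>carrier_verma\<close> these classes exhaust the module, so elements of the
  free algebra can replace formal sums of pairs.\<close>

definition tens :: "'k F \<Rightarrow> (('k F set \<times> 'k) \<Rightarrow>\<^sub>0 int) set" where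
  "tens p = pure_tensor (alg a) function_ring (cls a \<circ> fun_elem) (point_module g) (cls a p) 1"

definition coset :: "(('k F set \<times> 'k) \<Rightarrow>\<^sub>0 int) \<Rightarrow> (('k F set \<times> 'k) \<Rightarrow>\<^sub>0 int) set" where
  "coset P = (\<lambda>k. k + P) ` K"

lemma coset_eq: "K +>\<^bsub>FP\<^esub> P = coset P"
  by (simp add: coset_def a_r_coset_image FP_simps)

lemma coset_eq_iff: "coset P = coset Q \<longleftrightarrow> P - Q \<in> K"
  unfolding coset_def by (rule add_coset_eq_iff) (simp_all add: K_zero K_diff)

lemma tens_eq: "tens p = coset (frag_of (cls a p, 1))"
  by (simp add: tens_def pure_tensor_def coset_eq flip: K_def)

lemma verma_vec_eq: "verma_vec a g ts = tens (prod_list (map x\<^sub>F ts))"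
  by (simp add: verma_vec_def tens_def)

lemma verma_simps:
  "carrier (verma a g) = coset ` carrier FP"
  "\<zero>\<^bsub>verma a g\<^esub> = coset 0"
  "coset P \<oplus>\<^bsub>verma a g\<^esub> coset Q = coset (P + Q)"
  "cls a q \<odot>\<^bsub>verma a g\<^esub> coset P = coset (cls a q \<odot>\<^bsub>FP\<^esub> P)"
proof -
  show "carrier (verma a g) = coset ` carrier FP"
    by (auto simp: verma_def tensor_module_def quotient_module_def A_RCOSETS_def RCOSETS_def
        simp flip: coset_eq a_r_coset_def K_def)
  show "\<zero>\<^bsub>verma a g\<^esub> = coset 0"
    by (simp add: verma_def tensor_module_def quotient_module_def coset_def K_def)
  have "coset P \<oplus>\<^bsub>verma a g\<^esub> coset Q = (\<Union>x\<in>coset P. \<Union>y\<in>coset Q. {x + y})"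
    by (simp add: verma_def tensor_module_def quotient_module_def set_add_def set_mult_def FP_simps)
  also have "\<dots> = coset (P + Q)"
  proof (intro equalityI subsetI)
    fix x assume "x \<in> (\<Union>x\<in>coset P. \<Union>y\<in>coset Q. {x + y})"
    then obtain k l where "k \<in> K" "l \<in> K" "x = (k + l) + (P + Q)"
      by (auto simp: coset_def algebra_simps)
    then show "x \<in> coset (P + Q)" unfolding coset_def using K_add by blast
  next
    fix x assume "x \<in> coset (P + Q)"
    then obtain k where k: "k \<in> K" "x = (k + P) + (0 + Q)" by (auto simp: coset_def algebra_simps)
    with K_zero show "x \<in> (\<Union>x\<in>coset P. \<Union>y\<in>coset Q. {x + y})"
      unfolding coset_def by blast
  qed
  finally show "coset P \<oplus>\<^bsub>verma a g\<^esub> coset Q = coset (P + Q)" .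
  have "cls a q \<odot>\<^bsub>verma a g\<^esub> coset P = (\<Union>m\<in>coset P. coset (cls a q \<odot>\<^bsub>FP\<^esub> m))"
    by (simp add: verma_def tensor_module_def quotient_module_def coset_eq flip: K_def)
  also have "coset (cls a q \<odot>\<^bsub>FP\<^esub> m) = coset (cls a q \<odot>\<^bsub>FP\<^esub> P)" if m: "m \<in> coset P" for m
  proof -
    obtain k where "k \<in> K" "m = k + P" using m by (auto simp: coset_def)
    then show ?thesis
      using frag_scale_K[of k q] by (simp add: coset_eq_iff FP_simps frag_extend_add)
  qed
  then have "(\<Union>m\<in>coset P. coset (cls a q \<odot>\<^bsub>FP\<^esub> m)) = (\<Union>m\<in>coset P. coset (cls a q \<odot>\<^bsub>FP\<^esub> P))"
    by simp
  also have "\<dots> = coset (cls a q \<odot>\<^bsub>FP\<^esub> P)"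
    using K_zero by (auto simp: coset_def)
  finally show "cls a q \<odot>\<^bsub>verma a g\<^esub> coset P = coset (cls a q \<odot>\<^bsub>FP\<^esub> P)" .
qed

lemma tens_add: "tens p \<oplus>\<^bsub>verma a g\<^esub> tens q = tens (p + q)"
proof -
  have "frag_of (cls a p, 1) + frag_of (cls a q, 1) - frag_of (cls a (p + q), 1) \<in> K"
    using K_diff[OF K_zero K_Rel[OF Rel_memI(1)[of p q 1]]] by (simp add: algebra_simps)
  then show ?thesis by (simp add: tens_eq verma_simps coset_eq_iff)
qed

lemma tens_mult: "cls a q \<odot>\<^bsub>verma a g\<^esub> tens p = tens (q * p)"
  by (simp add: tens_eq verma_simps FP_simps alg_mult)

lemma zero_verma: "\<zero>\<^bsub>verma a g\<^esub> = tens 0"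
proof -
  have "frag_of (cls a 0, 1) - frag_of (cls a 0, 1) - frag_of (cls a 0, 1) \<in> K"
    using K_Rel[OF Rel_memI(1)[of 0 0 1]] by simp
  then show ?thesis by (simp add: tens_eq verma_simps coset_eq_iff)
qed

text \<open>A scalar enters the function ring as a constant function, which agrees with
  \<open>const\<close> modulo the relation that the \<delta>'s sum to 1. Balancing u and balancing
  the constant function with value \<open>u g\<close> lead to the same symbol (p, u(g)), so the two
  products have the same class.\<close>

lemma tens_fun_elem: "tens (p * fun_elem u) = tens (p * const (u g))"
proof -
  have "fun_elem (\<lambda>_. u g) = const (u g) * (\<Sum>h\<in>UNIV. \<delta>\<^sub>F h)"
    by (simp add: fun_elem_def sum_distrib_left)
  moreover have "const (u g) * ((\<Sum>h\<in>UNIV. \<delta>\<^sub>F h) - 1) \<in> relation_ideal a"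
    using relations_subset_ideal by (intro relation_ideal_closed(4)) (auto simp: relations_def)
  ultimately have "p * (fun_elem (\<lambda>_. u g) - const (u g)) \<in> relation_ideal a"
    by (intro relation_ideal_closed(4)) (simp add: algebra_simps)
  then have eq: "cls a (p * fun_elem (\<lambda>_. u g)) = cls a (p * const (u g))"
    by (simp add: cls_eq_iff algebra_simps)
  have "frag_of (cls a (p * fun_elem u), 1) - frag_of (cls a (p * const (u g)), 1) =
      (frag_of (cls a (p * fun_elem u), 1) - frag_of (cls a p, u g * 1)) -
      (frag_of (cls a (p * fun_elem (\<lambda>_. u g)), 1) - frag_of (cls a p, u g * 1))"
    by (simp add: eq)
  then have "frag_of (cls a (p * fun_elem u), 1) - frag_of (cls a (p * const (u g)), 1) \<in> K"
    using K_diff[OF K_Rel[OF Rel_memI(2)[of p u 1]] K_Rel[OF Rel_memI(2)[of p "\<lambda>_. u g" 1]]]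
    by simp
  then show ?thesis by (simp add: tens_eq coset_eq_iff)
qed

lemma coset_frag_of: "coset (frag_of (cls a p, c)) = tens (const c * p)"
proof -
  have "tens (p * fun_elem (\<lambda>_. c)) = coset (frag_of (cls a p, c))"
    using K_Rel[OF Rel_memI(2)[of p "\<lambda>_. c" 1]] by (simp add: tens_eq coset_eq_iff)
  then show ?thesis by (simp add: tens_fun_elem const_commute)
qed

lemma carrier_verma: "carrier (verma a g) = range tens"
proof (intro equalityI subsetI)
  fix m assume "m \<in> carrier (verma a g)"
  then obtain P where P: "Poly_Mapping.keys P \<subseteq> range (cls a) \<times> UNIV" "m = coset P"
    by (auto simp: verma_simps FP_simps)
  from P(1) have "coset P \<in> range tens"
  proof (induction rule: frag_induction)
    case zero
    show ?case using zero_verma by (simp add: verma_simps)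
  next
    case (one x)
    then show ?case by (auto simp: coset_frag_of)
  next
    case (diff P Q)
    then obtain p q where pq: "coset P = tens p" "coset Q = tens q" by auto
    \<comment> \<open>The difference is recovered from a sum: adding the class of Q to
      \<open>tens (p - q)\<close> gives the class of P.\<close>
    have "coset (frag_of (cls a (p - q), 1) + Q) = coset P"
      unfolding verma_simps(3)[symmetric] tens_eq[symmetric] pq tens_add by simp
    then have "coset (P - Q) = tens (p - q)"
      unfolding tens_eq coset_eq_iff
      using K_diff[OF K_zero, of "frag_of (cls a (p - q), 1) + Q - P"] by (simp add: algebra_simps)
    then show ?case by simp
  qed
  with P(2) show "m \<in> range tens" by simp
qed (auto simp: verma_simps tens_eq carrier_FP_closed)

lemma tens_cong: "p - q \<in> relation_ideal a \<Longrightarrow> tens p = tens q"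
  by (simp add: tens_def flip: cls_eq_iff)

text \<open>Universal property of the induced module, in the form that yields independence: since v
  has weight g, sending the pair (p, c) to the action of p on c v respects all tensor
  relations.\<close>

lemma tens_eq_imp:
  fixes sc :: "'k \<Rightarrow> 'b \<Rightarrow> 'b::ab_group_add"
  assumes "letter_action sc A" and kills: "\<And>p v. p \<in> relations a \<Longrightarrow> word_action sc A p v = 0"
    and weight: "\<And>h. A (Delta h) v = (if h = g then v else 0)"
    and eq: "tens p = tens q"
  shows "word_action sc A p v = word_action sc A q v"
proof -
  interpret letter_action sc A by fact
  have sc_zero_right: "sc c 0 = 0" for c using sc_add_right[of c 0 0] by simp
  \<comment> \<open>A class acts through an arbitrary representative; the choice is harmless because
    the relation ideal acts by zero.\<close>
  define val :: "'k F set \<Rightarrow> 'k \<Rightarrow> 'b" where "val C c = \<rho> (SOME p. C = cls a p) (sc c v)" for C c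
  have val_cls: "val (cls a p) c = \<rho> p (sc c v)" for p c
  proof -
    have "cls a p = cls a (SOME q. cls a p = cls a q)" by (rule someI) (rule refl)
    then have "p - (SOME q. cls a p = cls a q) \<in> relation_ideal a" by (simp add: cls_eq_iff)
    from word_action_relation_ideal[OF assms(1) kills this, of "sc c v"] show ?thesis
      by (simp add: val_def action_diff)
  qed
  define int_sc :: "int \<Rightarrow> 'b \<Rightarrow> 'b" where "int_sc z = sc (of_int z)" for z
  \<comment> \<open>Additive extension to the free abelian group; its integer coefficients act
    through \<open>of_int\<close>.\<close>
  define \<Phi> where "\<Phi> P = (\<Sum>x\<in>Poly_Mapping.keys P. int_sc (Poly_Mapping.lookup P x) (val (fst x) (snd x)))" for P
  have \<Phi>_add: "\<Phi> (P + Q) = \<Phi> P + \<Phi> Q" for P Q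
    unfolding \<Phi>_def by (rule setsum_keys_plus_distrib) (simp_all add: int_sc_def sc_zero_left sc_add_left)
  have \<Phi>_zero: "\<Phi> 0 = 0" by (simp add: \<Phi>_def)
  have \<Phi>_minus: "\<Phi> (- P) = - \<Phi> P" for P
    using \<Phi>_add[of "- P" P] by (simp add: \<Phi>_zero eq_neg_iff_add_eq_0)
  have \<Phi>_diff: "\<Phi> (P - Q) = \<Phi> P - \<Phi> Q" for P Q
    using \<Phi>_add[of P "- Q"] by (simp add: \<Phi>_minus)
  have \<Phi>_of: "\<Phi> (frag_of (cls a p, c)) = \<rho> p (sc c v)" for p c
    by (simp add: \<Phi>_def val_cls int_sc_def sc_one)
  have fun_elem: "\<rho> (fun_elem u) (sc c v) = sc (u g * c) v" for u c
    by (simp add: fun_elem_def action_simps A_sc weight if_distrib[of "sc _"] sc_zero_right sc_sc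
        sum.delta' cong: if_cong)
  have "\<Phi> k = 0" if "k \<in> K" for k
    using that
  proof (induction rule: K_induct)
    case (Rel r)
    then show ?case
      by (cases rule: Rel_cases)
        (simp_all add: \<Phi>_diff \<Phi>_of action_add action_add_right sc_add_left action_mult fun_elem)
  qed (simp_all add: \<Phi>_zero \<Phi>_add \<Phi>_minus)
  moreover have "frag_of (cls a p, 1) - frag_of (cls a q, 1) \<in> K"
    using eq by (simp add: tens_eq coset_eq_iff)
  ultimately have "\<Phi> (frag_of (cls a p, 1) - frag_of (cls a q, 1)) = 0" by blast
  then show ?thesis by (simp add: \<Phi>_diff \<Phi>_of sc_one)
qed

end

subsection \<open>A model of the Verma module\<close>

declare perm_of.simps [simp del]

lemma S3_distinct_rev: "distinct [rot', rot, g23, g13, g12, 1]"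
  using S3_distinct by auto

lemmas S3_neq [simp] = S3_distinct [simplified] S3_distinct_rev [simplified]

lemma transp_square: "perm_of t * (perm_of t * h) = h"
  by (cases t) (simp_all add: perm_of.simps flip: mult.assoc)

lemma transp_mult_eq_iff: "perm_of t * k = h \<longleftrightarrow> k = perm_of t * h"
  using transp_square by metis

text \<open>
  The four components have the bases \<open>1\<close>, \<open>x\<^sub>1\<^sub>2\<close>, \<open>x\<^sub>1\<^sub>3\<close>, \<open>x\<^sub>1\<^sub>2 x\<^sub>1\<^sub>3\<close> (a complement of the largest proper
  submodule), \<open>x\<^sub>1\<^sub>3 x\<^sub>1\<^sub>2\<close>, \<open>x\<^sub>1\<^sub>2 x\<^sub>2\<^sub>3\<close> (weight \<open>e\<close>), \<open>x\<^sub>2\<^sub>3\<close>, \<open>m\<^sub>o\<close> (weight \<open>(12)\<close>), and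
  \<open>x\<^sub>1\<^sub>2 x\<^sub>2\<^sub>3 x\<^sub>1\<^sub>3 x\<^sub>2\<^sub>3\<close>, \<open>x\<^sub>2\<^sub>3 x\<^sub>1\<^sub>3 x\<^sub>2\<^sub>3\<close>, \<open>x\<^sub>1\<^sub>2 x\<^sub>1\<^sub>3 x\<^sub>2\<^sub>3\<close>, \<open>x\<^sub>1\<^sub>3 x\<^sub>2\<^sub>3\<close> (the socle), applied to \<open>m\<^sub>1\<close>.
  The weights in the outer components are \<open>(13)(23)\<close>, \<open>(13)\<close>, \<open>(23)\<close>, \<open>(23)(13)\<close>.
\<close>

type_synonym 'k model =
  "('k \<times> 'k \<times> 'k \<times> 'k) \<times> ('k \<times> 'k) \<times> ('k \<times> 'k) \<times> ('k \<times> 'k \<times> 'k \<times> 'k)"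

fun scale :: "'k::field \<Rightarrow> 'k model \<Rightarrow> 'k model" where
  "scale c ((p, p1, p2, p3), (y, x), (u, w), (q, q1, q2, q3)) =
     ((c * p, c * p1, c * p2, c * p3), (c * y, c * x), (c * u, c * w), (c * q, c * q1, c * q2, c * q3))"

text \<open>The entries are the rewriting rules read in coordinates. For instance x23 x12 m_1 = -
  x12 x13 m_1 - x13 x23 m_1 accounts for both occurrences of \<open>- p1\<close> in the last
  equation.\<close>

fun act :: "'k::field \<Rightarrow> generator \<Rightarrow> 'k model \<Rightarrow> 'k model" where
  "act b (Delta g) ((p, p1, p2, p3), (y, x), (u, w), (q, q1, q2, q3)) =
     ((if g = rot then p else 0, if g = g13 then p1 else 0, if g = g23 then p2 else 0,
       if g = rot' then p3 else 0),
      (if g = 1 then y else 0, if g = 1 then x else 0), (if g = g12 then u else 0, if g = g12 then w else 0),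
      (if g = rot then q else 0, if g = g13 then q1 else 0, if g = g23 then q2 else 0,
       if g = rot' then q3 else 0))"
| "act b (Trans T12) ((p, p1, p2, p3), (y, x), (u, w), (q, q1, q2, q3)) =
     ((- b * p1, p, - b * p3, p2), (0, u), (0, y), (q1, - b * q, q3, - b * q2))"
| "act b (Trans T13) ((p, p1, p2, p3), (y, x), (u, w), (q, q1, q2, q3)) =
     ((b * p2, 0, p, 0), (p1, 0), (- b * p3, p3), (- q2, - x, - b * q, u + b * w))"
| "act b (Trans T23) ((p, p1, p2, p3), (y, x), (u, w), (q, q1, q2, q3)) =
     ((0, - b * p3, 0, - p1), (- p2, - p2), (p, 0), (w, q3 - p3, y - x, b * q1 - p1))"

lemma generator_cases:
  obtains (Delta) g where "s = Delta g" | (T12) "s = Trans T12" | (T13) "s = Trans T13"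
  | (T23) "s = Trans T23"
  by (metis generator.exhaust transp.exhaust)

lemma letter_action_model: "letter_action scale (act b)"
proof
  fix s and c :: 'a and v w :: "'a model"
  show "act b s (v + w) = act b s v + act b s w"
    by (cases s rule: generator_cases; cases v; cases w) (auto simp: algebra_simps)
  show "act b s (scale c v) = scale c (act b s v)"
    by (cases s rule: generator_cases; cases v) (auto simp: algebra_simps)
qed (auto simp: algebra_simps)

interpretation V: letter_action scale "act b" for b
  by (rule letter_action_model)

definition slope :: "(transp \<Rightarrow> 'k::field) \<Rightarrow> 'k" where
  "slope a = a T13 - a T12"

lemma f_fun_table:
  assumes "a T13 = a T23"
  shows
    "f_fun a T12 1 = 0" "f_fun a T12 g12 = 0" "f_fun a T12 g13 = - slope a"
    "f_fun a T12 g23 = - slope a" "f_fun a T12 rot = - slope a" "f_fun a T12 rot' = - slope a"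
    "f_fun a T13 1 = 0" "f_fun a T13 g12 = 0" "f_fun a T13 g13 = 0"
    "f_fun a T13 g23 = slope a" "f_fun a T13 rot = slope a" "f_fun a T13 rot' = 0"
    "f_fun a T23 1 = 0" "f_fun a T23 g12 = 0" "f_fun a T23 g13 = slope a"
    "f_fun a T23 g23 = 0" "f_fun a T23 rot = 0" "f_fun a T23 rot' = slope a"
  using assms by (simp_all add: f_fun_def conj_transp_table slope_def)

lemma sum_S3: "sum h UNIV = h 1 + h g12 + h g13 + h g23 + h rot + h rot'" for h :: "S3 \<Rightarrow> 'a::comm_monoid_add"
  unfolding S3_UNIV by (simp add: add.assoc)

lemma model_relations:
  fixes a :: "transp \<Rightarrow> 'k::field"
  assumes "a T13 = a T23" and "p \<in> relations a"
  shows "word_action scale (act (slope a)) p v = 0"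
proof -
  obtain p0 p1 p2 p3 y x u w q q1 q2 q3 where
    v: "v = ((p0, p1, p2, p3), (y, x), (u, w), (q, q1, q2, q3))" by (metis prod.exhaust)
  consider (delta) g h where "p = \<delta>\<^sub>F g * \<delta>\<^sub>F h - (if g = h then \<delta>\<^sub>F g else 0)"
    | (one) "p = (\<Sum>g\<in>UNIV. \<delta>\<^sub>F g) - 1"
    | (commute) h t where "p = \<delta>\<^sub>F h * x\<^sub>F t - x\<^sub>F t * \<delta>\<^sub>F (perm_of t * h)"
    | (square) t where "p = x\<^sub>F t * x\<^sub>F t - fun_elem (f_fun a t)"
    | (R1) "p = x\<^sub>F T13 * x\<^sub>F T23 + x\<^sub>F T23 * x\<^sub>F T12 + x\<^sub>F T12 * x\<^sub>F T13"
    | (R2) "p = x\<^sub>F T23 * x\<^sub>F T13 + x\<^sub>F T13 * x\<^sub>F T12 + x\<^sub>F T12 * x\<^sub>F T23"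
    using assms(2) by (auto simp: relations_def)
  then show ?thesis
  proof cases
    case delta
    then show ?thesis by (auto simp: V.action_simps v zero_prod_def)
  next
    case one
    then show ?thesis by (simp add: V.action_simps v zero_prod_def sum_S3)
  next
    case commute
    then show ?thesis
      using S3_cases[of h]
      by (cases t) (auto simp: V.action_simps v zero_prod_def S3_mult)
  next
    case square
    then show ?thesis
      by (cases t) (simp_all add: V.action_simps v zero_prod_def fun_elem_def sum_S3 f_fun_table[OF assms(1)]
          right_diff_distrib)
  next
    case R1
    then show ?thesis by (simp add: V.action_simps v zero_prod_def algebra_simps)
  next
    case R2
    then show ?thesis by (simp add: V.action_simps v zero_prod_def algebra_simps)
  qed
qed

subsection \<open>The Verma module at a rotation\<close>

locale verma_rot = verma_module a rot for a :: "transp \<Rightarrow> 'k::field" +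
  assumes a_eq: "a T13 = a T23"
begin

abbreviation b :: 'k where "b \<equiv> slope a"
abbreviation x12 :: "'k F" where "x12 \<equiv> x\<^sub>F T12"
abbreviation x13 :: "'k F" where "x13 \<equiv> x\<^sub>F T13"
abbreviation x23 :: "'k F" where "x23 \<equiv> x\<^sub>F T23"

text \<open>The left annihilator of m_1. Rewriting in the Verma module becomes congruence modulo
  this left ideal.\<close>

definition L :: "'k F set" where "L = {p. tens p = tens 0}"

lemma tens_eq_iff: "tens p = tens q \<longleftrightarrow> p - q \<in> L"
proof
  assume "tens p = tens q"
  then have "tens p \<oplus>\<^bsub>verma a rot\<^esub> tens (- q) = tens q \<oplus>\<^bsub>verma a rot\<^esub> tens (- q)" by simp
  then show "p - q \<in> L" by (simp add: tens_add L_def)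
next
  assume "p - q \<in> L"
  then have "tens (p - q) \<oplus>\<^bsub>verma a rot\<^esub> tens q = tens 0 \<oplus>\<^bsub>verma a rot\<^esub> tens q" by (simp add: L_def)
  then show "tens p = tens q" by (simp add: tens_add)
qed

lemma L_mult: "p \<in> L \<Longrightarrow> r * p \<in> L"
  using tens_mult[of r p] tens_mult[of r 0] by (simp add: L_def)

lemma L_zero: "0 \<in> L" by (simp add: L_def)

lemma L_add: "p \<in> L \<Longrightarrow> q \<in> L \<Longrightarrow> p + q \<in> L"
  using tens_add[of p q] tens_add[of 0 0] by (simp add: L_def)

lemma L_sum: "(\<And>i. i \<in> I \<Longrightarrow> f i \<in> L) \<Longrightarrow> sum f I \<in> L"
  by (induction I rule: infinite_finite_induct) (simp_all add: L_zero L_add)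

lemma L_diff: "p \<in> L \<Longrightarrow> q \<in> L \<Longrightarrow> p - q \<in> L"
  using L_add[of p "- q"] L_mult[of q "-1"] by simp

text \<open>L is only a left ideal, but relations may be multiplied on the right because they
  generate a two-sided ideal contained in L.\<close>

lemma L_relation: "p \<in> relations a \<Longrightarrow> p * r \<in> L"
  using tens_cong[of "p * r" 0] relations_subset_ideal relation_ideal_closed(5)[of p a r]
  by (auto simp: L_def)

definition has_weight :: "S3 \<Rightarrow> 'k F \<Rightarrow> bool" where
  "has_weight h p \<longleftrightarrow> (\<forall>k. \<delta>\<^sub>F k * p - (if k = h then p else 0) \<in> L)"

lemma has_weight_fun_elem:
  assumes "has_weight h p"
  shows "fun_elem u * p - const (u h) * p \<in> L"
proof -
  have "fun_elem u * p - const (u h) * p =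
    (\<Sum>k\<in>UNIV. const (u k) * (\<delta>\<^sub>F k * p - (if k = h then p else 0)))"
    by (simp add: fun_elem_def sum_distrib_right right_diff_distrib sum_subtractf mult.assoc
        if_distrib[of "\<lambda>x. _ * x"] cong: if_cong)
  also have "\<dots> \<in> L"
    using assms by (intro L_sum L_mult) (simp add: has_weight_def)
  finally show ?thesis .
qed

lemma has_weight_one: "has_weight rot 1"
proof -
  have delta: "\<delta>\<^sub>F k = fun_elem (\<lambda>g. if g = k then 1 else 0)" for k :: S3
    by (simp add: fun_elem_def if_distrib[of const] const_hom if_distrib[of "\<lambda>x. x * _"] cong: if_cong)
  show ?thesis
    unfolding has_weight_def
  proof
    fix k
    have "\<delta>\<^sub>F k - const (if rot = k then 1 else 0) \<in> L"
      using tens_fun_elem[of 1 "\<lambda>g. if g = k then 1 else 0"] by (simp add: tens_eq_iff delta)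
    then show "\<delta>\<^sub>F k * 1 - (if k = rot then 1 else 0) \<in> L"
      by (cases "k = rot") (simp_all add: const_hom)
  qed
qed

lemma has_weight_mult:
  assumes "has_weight h p"
  shows "has_weight (perm_of t * h) (x\<^sub>F t * p)"
  unfolding has_weight_def
proof
  fix k
  have "(\<delta>\<^sub>F k * x\<^sub>F t - x\<^sub>F t * \<delta>\<^sub>F (perm_of t * k)) * p \<in> L"
    by (rule L_relation) (auto simp: relations_def)
  moreover have "x\<^sub>F t * (\<delta>\<^sub>F (perm_of t * k) * p - (if perm_of t * k = h then p else 0)) \<in> L"
    using assms by (intro L_mult) (simp add: has_weight_def)
  ultimately have "(\<delta>\<^sub>F k * x\<^sub>F t - x\<^sub>F t * \<delta>\<^sub>F (perm_of t * k)) * p +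
     x\<^sub>F t * (\<delta>\<^sub>F (perm_of t * k) * p - (if perm_of t * k = h then p else 0)) \<in> L"
    by (rule L_add)
  then show "\<delta>\<^sub>F k * (x\<^sub>F t * p) - (if k = perm_of t * h then x\<^sub>F t * p else 0) \<in> L"
    by (simp add: algebra_simps transp_mult_eq_iff split: if_splits)
qed

text \<open>The square of x_t is a function on the group, hence a scalar on each weight space. This
  is how the weights of the words enter the rewriting.\<close>

lemma square:
  assumes "has_weight h p"
  shows "x\<^sub>F t * (x\<^sub>F t * p) - const (f_fun a t h) * p \<in> L"
proof -
  have "(x\<^sub>F t * x\<^sub>F t - fun_elem (f_fun a t)) * p \<in> L"
    by (rule L_relation) (auto simp: relations_def)
  from L_add[OF this has_weight_fun_elem[OF assms, of "f_fun a t"]] show ?thesis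
    by (simp add: algebra_simps)
qed

section \<open>Rewriting rules for words applied to the generator\<close>

lemma FK1: "(x13 * x23 + x23 * x12 + x12 * x13) * r \<in> L" and FK2: "(x23 * x13 + x13 * x12 + x12 * x23) * r \<in> L"
  by (rule L_relation; simp add: relations_def)+

lemma weights:
  "has_weight g13 x12" "has_weight g23 x13" "has_weight g12 x23"
  "has_weight rot' (x12 * x13)" "has_weight 1 (x13 * x12)" "has_weight 1 (x12 * x23)"
  "has_weight g12 (x13 * (x12 * x13))"
  "has_weight rot' (x13 * x23)" "has_weight g13 (x23 * (x13 * x23))" "has_weight g23 (x12 * (x13 * x23))"
  "has_weight rot (x12 * (x23 * (x13 * x23)))"
proof -
  note W = has_weight_mult
  show 1: "has_weight g13 x12" "has_weight g23 x13" "has_weight g12 x23"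
    using W[OF has_weight_one, of T12] W[OF has_weight_one, of T13] W[OF has_weight_one, of T23]
    by (simp_all add: S3_mult)
  show 2: "has_weight rot' (x12 * x13)" "has_weight 1 (x13 * x12)" "has_weight 1 (x12 * x23)"
    "has_weight rot' (x13 * x23)"
    using W[OF 1(2), of T12] W[OF 1(1), of T13] W[OF 1(3), of T12] W[OF 1(3), of T13]
    by (simp_all add: S3_mult)
  show 3: "has_weight g12 (x13 * (x12 * x13))" "has_weight g13 (x23 * (x13 * x23))" "has_weight g23 (x12 * (x13 * x23))"
    using W[OF 2(1), of T13] W[OF 2(4), of T23] W[OF 2(4), of T12] by (simp_all add: S3_mult)
  show "has_weight rot (x12 * (x23 * (x13 * x23)))"
    using W[OF 3(2), of T12] by (simp add: S3_mult)
qed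

text \<open>Constants are moved to the front of each word and ordered there, so that two elements
  can be compared as linear combinations of words.\<close>

lemmas free_simps = algebra_simps const_hom
  const_commute[of "letter s" for s] const_left_commute[of "letter s" for s]
  const_commute[of "const c" for c] const_left_commute[of "const c" for c]

lemma squares:
  "x12 * x12 + const b \<in> L" "x13 * x13 - const b \<in> L" "x23 * x23 \<in> L"
  "x12 * (x12 * x13) + const b * x13 \<in> L" "x13 * (x13 * x12) \<in> L" "x23 * (x23 * x12) - const b * x12 \<in> L"
  "x23 * (x23 * x13) \<in> L" "x12 * (x12 * x23) \<in> L" "x13 * (x13 * x23) \<in> L"
  "x13 * (x13 * (x12 * x13)) \<in> L" "x12 * (x12 * (x13 * x12)) \<in> L"
  "x13 * (x13 * (x12 * x23)) \<in> L" "x23 * (x23 * (x12 * x23)) \<in> L"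
  "x12 * (x12 * (x13 * x23)) + const b * (x13 * x23) \<in> L"
  "x23 * (x23 * (x13 * x23)) - const b * (x13 * x23) \<in> L"
  "x12 * (x12 * (x23 * (x13 * x23))) + const b * (x23 * (x13 * x23)) \<in> L"
  "x13 * (x13 * (x12 * (x13 * x23))) - const b * (x12 * (x13 * x23)) \<in> L"
  using square[OF has_weight_one, of T12] square[OF has_weight_one, of T13] square[OF has_weight_one, of T23]
    square[OF weights(2), of T12] square[OF weights(1), of T13] square[OF weights(1), of T23]
    square[OF weights(2), of T23] square[OF weights(3), of T12] square[OF weights(3), of T13]
    square[OF weights(4), of T13] square[OF weights(5), of T12]
    square[OF weights(6), of T13] square[OF weights(6), of T23]
    square[OF weights(8), of T12] square[OF weights(8), of T23] square[OF weights(9), of T12]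
    square[OF weights(10), of T13]
  by (simp_all add: f_fun_table[OF a_eq] const_hom)

lemma x23_x12: "x23 * x12 + x12 * x13 + x13 * x23 \<in> L"
  using FK1[of 1] by (simp add: algebra_simps)

lemma x23_x13: "x23 * x13 + x13 * x12 + x12 * x23 \<in> L"
  using FK2[of 1] by (simp add: algebra_simps)

lemma x23_x12_x13: "x23 * (x12 * x13) + const b * x12 + x23 * (x13 * x23) \<in> L"
  using L_diff[OF L_mult[OF FK1[of 1], of x23] squares(6)] by (simp add: free_simps)

lemma x23_x12_x23: "x23 * (x12 * x23) + x12 * (x13 * x23) \<in> L"
  using L_diff[OF FK1[of x23] L_mult[OF squares(3), of x13]] by (simp add: free_simps)

lemma x23_x13_x12: "x23 * (x13 * x12) - x12 * (x13 * x23) \<in> L"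
  using L_diff[OF L_diff[OF L_mult[OF FK2[of 1], of x23] squares(7)] x23_x12_x23]
  by (simp add: free_simps)

text \<open>Deformed braid relation. The first quadratic relation times x12 on the right, and times
  x13 on the left, share the term x13 x23 x12, which cancels. The remaining x23 x12 x12 contains a
  square at weight (13)(23) and contributes the correction b x23.\<close>

lemma x12_x13_x12: "x12 * (x13 * x12) - x13 * (x12 * x13) - const b * x23 \<in> L"
  using L_diff[OF L_add[OF L_diff[OF FK1[of x12] L_mult[OF FK1[of 1], of x13]] squares(9)]
      L_mult[OF squares(1), of x23]]
  by (simp add: free_simps)

lemma x13_x12_x23: "x13 * (x12 * x23) + x23 * (x13 * x23) \<in> L"
  using L_diff[OF FK2[of x23] L_mult[OF squares(3), of x12]] by (simp add: free_simps)

lemma x13_x23_x13_x23: "x13 * (x23 * (x13 * x23)) \<in> L"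
  using L_diff[OF L_mult[OF x13_x12_x23, of x13] squares(12)] by (simp add: free_simps)

lemma x23_x12_x13_x23: "x23 * (x12 * (x13 * x23)) \<in> L"
  using L_diff[OF L_mult[OF x23_x12_x23, of x23] squares(13)] by (simp add: free_simps)

lemma x13_x12_x13_x23: "x13 * (x12 * (x13 * x23)) + x12 * (x23 * (x13 * x23)) \<in> L"
  using L_diff[OF FK2[of "x13 * x23"] L_mult[OF squares(9), of x23]] by (simp add: free_simps)

lemma x13_x12_x23_x13_x23: "x13 * (x12 * (x23 * (x13 * x23))) + const b * (x12 * (x13 * x23)) \<in> L"
  using L_diff[OF L_mult[OF x13_x12_x13_x23, of x13] squares(17)] by (simp add: free_simps)

text \<open>In the first quadratic relation at x23 x13 x23 the other two summands vanish: one
  contains x13 x23 x13 x23, the other reduces to b x13 x13 x23.\<close>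

lemma x23_x12_x23_x13_x23: "x23 * (x12 * (x23 * (x13 * x23))) \<in> L"
  using L_diff[OF L_diff[OF L_diff[OF FK1[of "x23 * (x13 * x23)"]
        L_mult[OF x13_x23_x13_x23, of x12]] L_mult[OF squares(15), of x13]]
      L_mult[OF squares(9), of "const b"]]
  by (simp add: free_simps)

text \<open>The second quadratic relation at x12 x13 produces the squares x13 x13 and x12 x12. Their
  contributions of size b^2 to the coefficient of m_1 have opposite signs and cancel, which leaves
  only a socle vector.\<close>

lemma x23_x13_x12_x13:
  "x23 * (x13 * (x12 * x13)) - x12 * (x23 * (x13 * x23)) \<in> L"
proof -
  have "(x23 * x13 + x13 * x12 + x12 * x23) * (x12 * x13) - x13 * (x12 * (x12 * x13) + const b * x13)
    + const b * (x13 * x13 - const b) - x12 * (x23 * (x12 * x13) + const b * x12 + x23 * (x13 * x23))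
    + const b * (x12 * x12 + const b) \<in> L"
    by (intro L_add L_diff L_mult FK2 squares x23_x12_x13)
  then show ?thesis by (simp add: free_simps)
qed

lemma x12_x13_x12_x13: "x12 * (x13 * (x12 * x13)) + const b * (x12 * x23) \<in> L"
  using L_diff[OF squares(11) L_mult[OF x12_x13_x12, of x12]] by (simp add: free_simps)

section \<open>Normal forms\<close>

fun lift :: "'k model \<Rightarrow> 'k F" where
  "lift ((p, p1, p2, p3), (y, x), (u, w), (q, q1, q2, q3)) =
     const p + const p1 * x12 + const p2 * x13 + const p3 * (x12 * x13) +
     const y * (x13 * x12) + const x * (x12 * x23) +
     const u * x23 + const w * (x13 * (x12 * x13) + const b * x23) +
     const q * (x12 * (x23 * (x13 * x23))) + const q1 * (x23 * (x13 * x23)) +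
     const q2 * (x12 * (x13 * x23)) + const q3 * (x13 * x23)"

lemma lift_add: "lift (v + v') = lift v + lift v'"
  by (cases v; cases v') (auto simp: const_hom algebra_simps)

abbreviation \<rho> :: "'k F \<Rightarrow> 'k model \<Rightarrow> 'k model" where "\<rho> \<equiv> word_action scale (act b)"

definition base :: "'k model" where "base = ((1, 0, 0, 0), (0, 0), (0, 0), (0, 0, 0, 0))"

text \<open>The coordinates of a normal form can be read off from its action on \<open>base\<close>;
  this is what makes \<open>\<Psi>\<close> injective.\<close>

lemma action_lift: "\<rho> (lift v) base = v"
  by (cases v) (auto simp: V.action_simps base_def)

text \<open>The combination below has one summand for each basis vector whose product with x12 is
  not again a basis vector, weighted by its coordinate.\<close>

lemma x12_lift:
  "x12 * lift v - lift (act b (Trans T12) v) \<in> L"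
proof -
  obtain p p1 p2 p3 y x u w q q1 q2 q3 where
    v: "v = ((p, p1, p2, p3), (y, x), (u, w), (q, q1, q2, q3))" by (metis prod.exhaust)
  have "const p1 * (x12 * x12 + const b) + const p3 * (x12 * (x12 * x13) + const b * x13)
    + const y * (x12 * (x13 * x12) - x13 * (x12 * x13) - const b * x23)
    + const x * (x12 * (x12 * x23)) + const w * (x12 * (x13 * (x12 * x13)) + const b * (x12 * x23))
    + const q * (x12 * (x12 * (x23 * (x13 * x23))) + const b * (x23 * (x13 * x23)))
    + const q2 * (x12 * (x12 * (x13 * x23)) + const b * (x13 * x23)) \<in> L"
    by (intro L_add L_mult squares x12_x13_x12 x12_x13_x12_x13)
  then show ?thesis by (simp add: v free_simps)
qed

lemma x13_lift:
  "x13 * lift v - lift (act b (Trans T13) v) \<in> L"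
proof -
  obtain p p1 p2 p3 y x u w q q1 q2 q3 where
    v: "v = ((p, p1, p2, p3), (y, x), (u, w), (q, q1, q2, q3))" by (metis prod.exhaust)
  have "const p2 * (x13 * x13 - const b) + const y * (x13 * (x13 * x12))
    + const x * (x13 * (x12 * x23) + x23 * (x13 * x23))
    + const w * (x13 * (x13 * (x12 * x13)))
    + const q * (x13 * (x12 * (x23 * (x13 * x23))) + const b * (x12 * (x13 * x23)))
    + const q1 * (x13 * (x23 * (x13 * x23)))
    + const q2 * (x13 * (x12 * (x13 * x23)) + x12 * (x23 * (x13 * x23)))
    + const q3 * (x13 * (x13 * x23)) \<in> L"
    by (intro L_add L_mult squares x13_x12_x23 x13_x12_x23_x13_x23 x13_x23_x13_x23 x13_x12_x13_x23)
  then show ?thesis by (simp add: v free_simps)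
qed

lemma x23_lift:
  "x23 * lift v - lift (act b (Trans T23) v) \<in> L"
proof -
  obtain p p1 p2 p3 y x u w q q1 q2 q3 where
    v: "v = ((p, p1, p2, p3), (y, x), (u, w), (q, q1, q2, q3))" by (metis prod.exhaust)
  have "const p1 * (x23 * x12 + x12 * x13 + x13 * x23)
    + const p2 * (x23 * x13 + x13 * x12 + x12 * x23)
    + const p3 * (x23 * (x12 * x13) + const b * x12 + x23 * (x13 * x23))
    + const y * (x23 * (x13 * x12) - x12 * (x13 * x23))
    + const x * (x23 * (x12 * x23) + x12 * (x13 * x23))
    + const u * (x23 * x23)
    + const w * (x23 * (x13 * (x12 * x13)) - x12 * (x23 * (x13 * x23)) + const b * (x23 * x23))
    + const q * (x23 * (x12 * (x23 * (x13 * x23))))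
    + const q1 * (x23 * (x23 * (x13 * x23)) - const b * (x13 * x23))
    + const q2 * (x23 * (x12 * (x13 * x23))) \<in> L"
    by (intro L_add L_mult squares x23_x12 x23_x13 x23_x12_x13 x23_x13_x12 x23_x12_x23 x23_x13_x12_x13
        x23_x12_x23_x13_x23 x23_x12_x13_x23)
  then show ?thesis by (simp add: v free_simps)
qed

lemma delta_lift: "\<delta>\<^sub>F g * lift v - lift (act b (Delta g) v) \<in> L"
proof -
  obtain p p1 p2 p3 y x u w q q1 q2 q3 where
    v: "v = ((p, p1, p2, p3), (y, x), (u, w), (q, q1, q2, q3))" by (metis prod.exhaust)
  have wt: "c * (\<delta>\<^sub>F g * r - (if g = h then r else 0)) \<in> L" if "has_weight h r" for c h r
    using that by (intro L_mult) (simp add: has_weight_def)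
  \<comment> \<open>The coordinate w belongs to x13 x12 x13 + b x23, hence the coefficient
    \<open>u + w * b\<close> at the word x23.\<close>
  have "const p * (\<delta>\<^sub>F g * 1 - (if g = rot then 1 else 0))
    + const p1 * (\<delta>\<^sub>F g * x12 - (if g = g13 then x12 else 0))
    + const p2 * (\<delta>\<^sub>F g * x13 - (if g = g23 then x13 else 0))
    + const p3 * (\<delta>\<^sub>F g * (x12 * x13) - (if g = rot' then (x12 * x13) else 0))
    + const y * (\<delta>\<^sub>F g * (x13 * x12) - (if g = 1 then (x13 * x12) else 0))
    + const x * (\<delta>\<^sub>F g * (x12 * x23) - (if g = 1 then (x12 * x23) else 0))
    + const (u + w * b) * (\<delta>\<^sub>F g * x23 - (if g = g12 then x23 else 0))
    + const w * (\<delta>\<^sub>F g * (x13 * (x12 * x13)) - (if g = g12 then (x13 * (x12 * x13)) else 0))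
    + const q * (\<delta>\<^sub>F g * (x12 * (x23 * (x13 * x23))) - (if g = rot then (x12 * (x23 * (x13 * x23))) else 0))
    + const q1 * (\<delta>\<^sub>F g * (x23 * (x13 * x23)) - (if g = g13 then (x23 * (x13 * x23)) else 0))
    + const q2 * (\<delta>\<^sub>F g * (x12 * (x13 * x23)) - (if g = g23 then (x12 * (x13 * x23)) else 0))
    + const q3 * (\<delta>\<^sub>F g * (x13 * x23) - (if g = rot' then (x13 * x23) else 0)) \<in> L"
    by (intro L_add wt weights has_weight_one)
  with S3_cases[of g] show ?thesis by (elim insertE) (simp_all add: v free_simps)
qed

end

subsection \<open>Transport of submodules along a parametrization\<close>

text \<open>Instantiated twice with the same parametrization: over the algebra, indexed by free
  algebra elements with \<open>r = cls a\<close>, and over the scalars, where generated submodules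
  are linear spans. The index map r need not be injective.\<close>

locale module_model =
  fixes R :: "('r, 'c) ring_scheme" and M :: "('r, 'm, 'd) module_scheme"
    and \<Psi> :: "'b::ab_group_add \<Rightarrow> 'm" and r :: "'j \<Rightarrow> 'r" and \<alpha> :: "'j \<Rightarrow> 'b \<Rightarrow> 'b"
  assumes carrier_R: "carrier R = range r" and carrier_M: "carrier M = range \<Psi>"
    and inj_\<Psi>: "inj \<Psi>"
    and \<Psi>_add: "\<Psi> v \<oplus>\<^bsub>M\<^esub> \<Psi> w = \<Psi> (v + w)" and \<Psi>_zero: "\<zero>\<^bsub>M\<^esub> = \<Psi> 0"
    and \<Psi>_smult: "r j \<odot>\<^bsub>M\<^esub> \<Psi> v = \<Psi> (\<alpha> j v)"
begin

definition stable :: "'b set \<Rightarrow> bool" where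
  "stable U \<longleftrightarrow> 0 \<in> U \<and> (\<forall>v\<in>U. \<forall>w\<in>U. v + w \<in> U) \<and> (\<forall>v\<in>U. - v \<in> U) \<and> (\<forall>j. \<forall>v\<in>U. \<alpha> j v \<in> U)"

lemma group_M: "group (add_monoid M)"
proof (rule groupI)
  fix m assume "m \<in> carrier (add_monoid M)"
  then obtain v where "m = \<Psi> v" by (auto simp: carrier_M)
  then show "\<exists>m'\<in>carrier (add_monoid M). m' \<otimes>\<^bsub>add_monoid M\<^esub> m = \<one>\<^bsub>add_monoid M\<^esub>"
    by (intro bexI[of _ "\<Psi> (- v)"]) (simp_all add: \<Psi>_add \<Psi>_zero carrier_M)
qed (auto simp: carrier_M \<Psi>_add \<Psi>_zero add.assoc)

lemma a_inv_\<Psi>: "\<ominus>\<^bsub>M\<^esub> \<Psi> v = \<Psi> (- v)"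
  unfolding a_inv_def
  by (rule group.inv_equality[OF group_M]) (simp_all add: \<Psi>_add \<Psi>_zero carrier_M)

lemma a_minus_\<Psi>: "\<Psi> v \<ominus>\<^bsub>M\<^esub> \<Psi> w = \<Psi> (v - w)"
  by (simp add: a_minus_def a_inv_\<Psi> \<Psi>_add)

lemma \<Psi>_mem_iff: "\<Psi> v \<in> \<Psi> ` U \<longleftrightarrow> v \<in> U"
  using inj_\<Psi> by (auto dest: injD)

lemma submodule_image_iff: "submodule (\<Psi> ` U) R M \<longleftrightarrow> stable U"
proof
  assume "submodule (\<Psi> ` U) R M"
  then interpret submodule "\<Psi> ` U" R M .
  have "\<Psi> 0 \<in> \<Psi> ` U" using one_closed by (simp add: \<Psi>_zero)
  moreover have "\<Psi> (v + w) \<in> \<Psi> ` U" if "v \<in> U" "w \<in> U" for v w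
    using m_closed[of "\<Psi> v" "\<Psi> w"] that by (simp add: \<Psi>_add)
  moreover have "\<Psi> (- v) \<in> \<Psi> ` U" if "v \<in> U" for v
    using m_inv_closed[of "\<Psi> v"] that by (simp flip: a_inv_def add: a_inv_\<Psi>)
  moreover have "\<Psi> (\<alpha> j v) \<in> \<Psi> ` U" if "v \<in> U" for j v
    using smult_closed[of "r j" "\<Psi> v"] that by (simp add: carrier_R \<Psi>_smult)
  ultimately show "stable U"
    unfolding stable_def by (simp add: \<Psi>_mem_iff)
next
  assume U: "stable U"
  show "submodule (\<Psi> ` U) R M"
  proof (intro submodule.intro subgroup.intro submodule_axioms.intro)
    fix m assume "m \<in> \<Psi> ` U"
    then show "inv\<^bsub>add_monoid M\<^esub> m \<in> \<Psi> ` U"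
      using U by (auto simp: stable_def a_inv_\<Psi> simp flip: a_inv_def)
  qed (use U in \<open>auto simp: carrier_M carrier_R \<Psi>_add \<Psi>_zero \<Psi>_smult stable_def\<close>)
qed

lemma submodule_iff: "submodule N R M \<longleftrightarrow> (\<exists>U. stable U \<and> N = \<Psi> ` U)"
proof
  assume N: "submodule N R M"
  then have "N \<subseteq> range \<Psi>"
    using subgroup.subset[OF submodule.axioms(1)] by (fastforce simp: carrier_M)
  then obtain U where "N = \<Psi> ` U" by (metis subset_imageE)
  with N show "\<exists>U. stable U \<and> N = \<Psi> ` U" by (auto simp: submodule_image_iff)
qed (auto simp: submodule_image_iff)

text \<open>An injective map commutes with the intersection of a nonempty family;
  \<open>UNIV\<close> is a member of this one.\<close>

lemma generated_submodule_image:
  "generated_submodule R M (\<Psi> ` S) = \<Psi> ` \<Inter>{U. stable U \<and> S \<subseteq> U}"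
proof -
  have "{N. submodule N R M \<and> \<Psi> ` S \<subseteq> N} = (`) \<Psi> ` {U. stable U \<and> S \<subseteq> U}"
    using inj_\<Psi> by (auto simp: submodule_iff inj_image_subset_iff)
  moreover have "stable UNIV" by (simp add: stable_def)
  ultimately show ?thesis
    using image_INT[OF inj_\<Psi>, of "{U. stable U \<and> S \<subseteq> U}" "\<lambda>U. U" UNIV]
    by (simp add: generated_submodule_def)
qed

lemma generated_submodule_eqI:
  assumes "stable U" "S \<subseteq> U" "\<And>U'. stable U' \<Longrightarrow> S \<subseteq> U' \<Longrightarrow> U \<subseteq> U'"
  shows "generated_submodule R M (\<Psi> ` S) = \<Psi> ` U"
proof -
  have "\<Inter>{U. stable U \<and> S \<subseteq> U} = U" using assms by blast
  then show ?thesis by (simp add: generated_submodule_image)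
qed

text \<open>First isomorphism theorem. The cosets of W in U are the images of the fibres of
  \<open>\<l>\<close> on U, so a coset depends on its representative only through the value of
  \<open>\<l>\<close>.\<close>

lemma quotient_isomorphic:
  fixes N :: "('r, 'n::ab_group_add, 'e) module_scheme" and \<l> :: "'b \<Rightarrow> 'n"
  assumes U: "stable U" and W: "W = {v \<in> U. \<l> v = 0}"
    and add: "\<And>v w. \<l> (v + w) = \<l> v + \<l> w"
    and surj: "\<l> ` U = UNIV"
    and smult: "\<And>j v. v \<in> U \<Longrightarrow> \<l> (\<alpha> j v) = r j \<odot>\<^bsub>N\<^esub> \<l> v"
    and N: "carrier N = UNIV" "\<And>c d. c \<oplus>\<^bsub>N\<^esub> d = c + d" "\<And>j. r j \<odot>\<^bsub>N\<^esub> 0 = 0"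
  shows "module_isomorphic R (quotient_module (M\<lparr>carrier := \<Psi> ` U\<rparr>) (\<Psi> ` W)) N"
proof -
  let ?Q = "quotient_module (M\<lparr>carrier := \<Psi> ` U\<rparr>) (\<Psi> ` W)"
  define C where "C v = \<Psi> ` {w \<in> U. \<l> w = \<l> v}" for v
  have zero: "\<l> 0 = 0" using add[of 0 0] by simp
  have minus: "\<l> (- v) = - \<l> v" for v using add[of "- v" v] by (simp add: zero eq_neg_iff_add_eq_0)
  have U_add: "v + w \<in> U" if "v \<in> U" "w \<in> U" for v w using U that by (simp add: stable_def)
  have U_minus: "v - w \<in> U" if "v \<in> U" "w \<in> U" for v w
    using U that by (metis stable_def diff_conv_add_uminus)
  have U_\<alpha>: "\<alpha> j v \<in> U" if "v \<in> U" for j v using U that by (simp add: stable_def)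
  have coset: "\<Psi> ` W +>\<^bsub>M'\<^esub> \<Psi> v = C v" if v: "v \<in> U" and M': "add M' = add M" for v and M' :: "('r, 'm, 'd) module_scheme"
  proof -
    have "\<Psi> ` W +>\<^bsub>M'\<^esub> \<Psi> v = (\<lambda>w. \<Psi> (w + v)) ` W"
      by (auto simp: a_r_coset_defs M' \<Psi>_add)
    also have "\<dots> = C v"
    proof (intro equalityI subsetI)
      fix m assume "m \<in> C v"
      then obtain w where "w \<in> U" "\<l> w = \<l> v" "m = \<Psi> w" by (auto simp: C_def)
      then have "m = \<Psi> ((w - v) + v)" "w - v \<in> W"
        using v U_minus add[of w "- v"] by (auto simp: W minus)
      then show "m \<in> (\<lambda>w. \<Psi> (w + v)) ` W" by blast
    qed (auto simp: C_def W add U_add v)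
    finally show ?thesis .
  qed
  have C_eq_iff: "C v = C w \<longleftrightarrow> \<l> v = \<l> w" if "v \<in> U" "w \<in> U" for v w
  proof
    assume "C v = C w"
    moreover have "\<Psi> v \<in> C v" using that by (simp add: C_def)
    ultimately show "\<l> v = \<l> w" by (auto simp: C_def \<Psi>_mem_iff)
  qed (simp add: C_def)
  have carrier: "carrier ?Q = C ` U"
  proof -
    have "carrier ?Q = (\<Union>v\<in>U. {\<Psi> ` W +>\<^bsub>M\<lparr>carrier := \<Psi> ` U\<rparr>\<^esub> \<Psi> v})"
      by (simp add: quotient_module_def A_RCOSETS_def RCOSETS_def a_r_coset_def)
    also have "\<dots> = (\<Union>v\<in>U. {C v})"
      by (intro SUP_cong refl) (simp add: coset)
    finally show ?thesis by auto
  qed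
  have Q_add: "C v \<oplus>\<^bsub>?Q\<^esub> C w = C (v + w)" if "v \<in> U" "w \<in> U" for v w
  proof -
    have "C v \<oplus>\<^bsub>?Q\<^esub> C w = (\<Union>x\<in>C v. \<Union>y\<in>C w. {x \<oplus>\<^bsub>M\<^esub> y})"
      by (simp add: quotient_module_def set_add_def set_mult_def)
    also have "\<dots> = C (v + w)"
    proof (intro equalityI subsetI)
      fix m assume "m \<in> C (v + w)"
      then obtain u where u: "u \<in> U" "\<l> u = \<l> v + \<l> w" "m = \<Psi> u" by (auto simp: C_def add)
      then have "m = \<Psi> (u - w) \<oplus>\<^bsub>M\<^esub> \<Psi> w" "\<Psi> (u - w) \<in> C v" "\<Psi> w \<in> C w"
        using that U_minus add[of u "- w"] by (auto simp: C_def minus \<Psi>_add)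
      then show "m \<in> (\<Union>x\<in>C v. \<Union>y\<in>C w. {x \<oplus>\<^bsub>M\<^esub> y})" by blast
    qed (auto simp: C_def \<Psi>_add add U_add)
    finally show ?thesis .
  qed
  have Q_smult: "r j \<odot>\<^bsub>?Q\<^esub> C v = C (\<alpha> j v)" if v: "v \<in> U" for j v
  proof -
    have "r j \<odot>\<^bsub>?Q\<^esub> C v = (\<Union>m\<in>C v. \<Psi> ` W +>\<^bsub>M\<lparr>carrier := \<Psi> ` U\<rparr>\<^esub> (r j \<odot>\<^bsub>M\<^esub> m))"
      by (simp add: quotient_module_def)
    also have "\<Psi> ` W +>\<^bsub>M\<lparr>carrier := \<Psi> ` U\<rparr>\<^esub> (r j \<odot>\<^bsub>M\<^esub> m) = C (\<alpha> j v)" if m: "m \<in> C v" for m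
    proof -
      obtain w where w: "w \<in> U" "\<l> w = \<l> v" "m = \<Psi> w" using m by (auto simp: C_def)
      then have "C (\<alpha> j w) = C (\<alpha> j v)" using v U_\<alpha> by (simp add: C_eq_iff smult)
      with w show ?thesis by (simp add: \<Psi>_smult coset U_\<alpha>)
    qed
    then have "(\<Union>m\<in>C v. \<Psi> ` W +>\<^bsub>M\<lparr>carrier := \<Psi> ` U\<rparr>\<^esub> (r j \<odot>\<^bsub>M\<^esub> m)) = (\<Union>m\<in>C v. C (\<alpha> j v))"
      by simp
    also have "\<dots> = C (\<alpha> j v)" using v by (auto simp: C_def)
    finally show ?thesis .
  qed
  \<comment> \<open>By \<open>C_eq_iff\<close> every representative of the coset gives the same
    value.\<close>
  define f where "f A = \<l> (SOME v. v \<in> U \<and> A = C v)" for A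
  have f: "f (C v) = \<l> v" if "v \<in> U" for v
  proof -
    have "(SOME w. w \<in> U \<and> C v = C w) \<in> U \<and> C v = C (SOME w. w \<in> U \<and> C v = C w)"
      by (rule someI[of _ v]) (simp add: that)
    then show ?thesis unfolding f_def using C_eq_iff[OF that] by auto
  qed
  show ?thesis
    unfolding module_isomorphic_def
  proof (intro bexI[of _ f] ballI)
    fix c m assume "c \<in> carrier R" "m \<in> carrier ?Q"
    then show "f (c \<odot>\<^bsub>?Q\<^esub> m) = c \<odot>\<^bsub>N\<^esub> f m"
      by (auto simp: carrier_R carrier Q_smult f U_\<alpha> smult)
  next
    have "inj_on f (C ` U)" by (auto simp: inj_on_def f C_eq_iff)
    moreover have "f ` C ` U = UNIV" using surj by (force simp: image_image f cong: image_cong)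
    ultimately show "f \<in> iso (add_monoid ?Q) (add_monoid N)"
      by (auto simp: iso_def hom_def bij_betw_def carrier N(1,2) Q_add f U_add add)
  qed
qed

end

subsection \<open>Simple modules\<close>

text \<open>All x_t act by zero, so the only possible obstruction comes from x_t squared, whose
  prescribed value f_t(h) vanishes by assumption.\<close>

lemma simple_char_relations:
  assumes "\<And>t. f_fun a t h = 0" and "p \<in> relations a"
  shows "word_action (*) (\<lambda>s. (*) (simple_char h s)) p c = (0 :: 'k::field)"
proof -
  interpret letter_action "(*)" "\<lambda>s. (*) (simple_char h s :: 'k)" by (rule letter_action_mult)
  have fun_elem: "\<rho> (fun_elem u) c = u h * c" for u
  proof -
    have "\<rho> (fun_elem u) c = (\<Sum>g\<in>UNIV. if g = h then u g * c else 0)"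
      unfolding fun_elem_def action_sum by (intro sum.cong) (auto simp: action_simps)
    then show ?thesis by simp
  qed
  moreover have "(\<Sum>g\<in>UNIV. \<delta>\<^sub>F g) = (fun_elem (\<lambda>_. 1) :: 'k F)"
    by (simp add: fun_elem_def const_hom)
  ultimately show ?thesis
    using assms by (auto simp: relations_def action_simps)
qed

text \<open>The character kills the relation ideal, so the set from which \<open>the_elem\<close>
  reads the scalar is a singleton.\<close>

lemma simple_module_smult:
  assumes "\<And>t. f_fun a t h = 0"
  shows "cls a p \<odot>\<^bsub>simple_module h\<^esub> c = word_action (*) (\<lambda>s. (*) (simple_char h s)) p (c :: 'k::field)"
proof -
  interpret letter_action "(*)" "\<lambda>s. (*) (simple_char h s :: 'k)" by (rule letter_action_mult)
  have "eval (simple_char h) (q + p) = eval (simple_char h) p" if "q \<in> relation_ideal a" for q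
    using word_action_relation_ideal[OF letter_action_mult simple_char_relations[OF assms] that]
    by (simp add: eval_eq_word_action action_add)
  then have "eval (simple_char h) ` cls a p = {eval (simple_char h) p}"
    using relation_ideal_closed(1) by (force simp: cls_eq)
  then have "cls a p \<odot>\<^bsub>simple_module h\<^esub> c = eval (simple_char h) p * c"
    by (simp add: simple_module_def)
  also have "\<dots> = \<rho> p c"
  proof (induction p rule: free_algebra_induct)
    case (letter s p)
    then show ?case by (simp add: eval_eq_word_action action_simps mult.assoc)
  qed (simp_all add: eval_eq_word_action action_simps distrib_right)
  finally show ?thesis .
qed

subsection \<open>Submodules of the Verma module\<close>

context verma_rot
begin

text \<open>The spanning half: by induction, a letter applied to a normal form is replaced by the
  normal form that the table predicts.\<close>

lemma tens_lift: "tens (lift (\<rho> p base)) = tens p"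
proof (induction p rule: free_algebra_induct)
  case (const c)
  then show ?case by (simp add: V.action_simps base_def const_hom)
next
  case (letter s p)
  have "letter s * lift v - lift (act b s v) \<in> L" for v
    by (cases s rule: generator_cases) (simp_all add: x12_lift x13_lift x23_lift delta_lift)
  then have "tens (lift (\<rho> (letter s * p) base)) = tens (letter s * lift (\<rho> p base))"
    by (simp add: tens_eq_iff[symmetric] V.action_simps)
  also have "\<dots> = tens (letter s * p)"
    using letter tens_mult[of "letter s"] by metis
  finally show ?case .
next
  case (add p q)
  then show ?case using tens_add by (metis V.action_add lift_add)
qed

definition \<Psi> :: "'k model \<Rightarrow> (('k F set \<times> 'k) \<Rightarrow>\<^sub>0 int) set" where
  "\<Psi> v = tens (lift v)"

lemma tens_eq_\<Psi>: "tens p = \<Psi> (\<rho> p base)"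
  by (simp add: \<Psi>_def tens_lift)

text \<open>The independence half: the model satisfies the relations and \<open>base\<close> has the
  weight of m_1, so the universal property applies.\<close>

lemma action_eq_of_tens_eq: "tens p = tens q \<Longrightarrow> \<rho> p base = \<rho> q base"
  by (rule tens_eq_imp[OF letter_action_model model_relations[OF a_eq]]) (simp_all add: base_def zero_prod_def)

lemma Ver_eq: "Ver a = verma a rot"
  by (simp add: Ver_def rot_def)

sublocale A: module_model "alg a" "Ver a" \<Psi> "cls a" \<rho>
proof
  show "inj \<Psi>"
    by (rule injI) (metis \<Psi>_def action_eq_of_tens_eq action_lift)
  show "carrier (Ver a) = range \<Psi>"
    unfolding Ver_eq carrier_verma using tens_eq_\<Psi> \<Psi>_def by blast
  show "\<zero>\<^bsub>Ver a\<^esub> = \<Psi> 0"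
    by (simp add: Ver_eq zero_verma tens_eq_\<Psi> V.action_zero)
  show "cls a p \<odot>\<^bsub>Ver a\<^esub> \<Psi> v = \<Psi> (\<rho> p v)" for p v
    by (simp add: Ver_eq \<Psi>_def tens_mult flip: tens_lift[of "p * lift v"]) (simp add: V.action_mult action_lift)
  show "\<Psi> v \<oplus>\<^bsub>Ver a\<^esub> \<Psi> w = \<Psi> (v + w)" for v w
    by (simp add: Ver_eq \<Psi>_def tens_add lift_add)
qed (rule carrier_alg)

sublocale S: module_model "ring_of_type_algebra" "scalars a (Ver a)" \<Psi> "\<lambda>c. c" scale
proof
  show "c \<odot>\<^bsub>scalars a (Ver a)\<^esub> \<Psi> v = \<Psi> (scale c v)" for c v
    by (simp add: scalars_def restrict_scalars_def A.\<Psi>_smult V.action_const)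
qed (simp_all add: scalars_def restrict_scalars_def A.carrier_M A.\<Psi>_add A.\<Psi>_zero A.inj_\<Psi>
    ring_of_type_algebra_simps)

end

section \<open>Subspaces of a plane\<close>

datatype 'k line = Zero | Base | Line 'k | Full

text \<open>Each subspace has exactly one code, with lines off the second axis coded by their slope.
  The second axis \<open>Base\<close> is spanned by m_(12)(23) in M[e] and by m_o in M[(12)]; it is
  the kernel of x12 on its plane and the image of x12 from the other one.\<close>

fun sub2 :: "'k::field line \<Rightarrow> ('k \<times> 'k) set" where
  "sub2 Zero = {0}"
| "sub2 Base = {(0, z) | z. True}"
| "sub2 (Line c) = {(z, c * z) | z. True}"
| "sub2 Full = UNIV"

lemma sub2_mem_iff:
  "(y, x) \<in> sub2 Zero \<longleftrightarrow> y = 0 \<and> x = 0" "(y, x) \<in> sub2 Base \<longleftrightarrow> y = 0"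
  "(y, x) \<in> sub2 (Line c) \<longleftrightarrow> x = c * y" "(y, x) \<in> sub2 Full"
  by (auto simp: zero_prod_def)

lemma sub2_closed:
  "(0, 0) \<in> sub2 l" "(y, x) \<in> sub2 l \<Longrightarrow> (y', x') \<in> sub2 l \<Longrightarrow> (y + y', x + x') \<in> sub2 l"
  "(y, x) \<in> sub2 l \<Longrightarrow> (c * y, c * x) \<in> sub2 l"
  by (cases l; simp add: sub2_mem_iff algebra_simps del: sub2.simps)+

lemma sub2_surj:
  fixes T :: "('k::field \<times> 'k) set"
  assumes zero: "(0, 0) \<in> T"
    and add: "\<And>y x y' x'. (y, x) \<in> T \<Longrightarrow> (y', x') \<in> T \<Longrightarrow> (y + y', x + x') \<in> T"
    and scale: "\<And>c y x. (y, x) \<in> T \<Longrightarrow> (c * y, c * x) \<in> T"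
  obtains l where "T = sub2 l"
proof -
  have "\<exists>l. T = sub2 l"
  proof (cases "\<exists>x. x \<noteq> 0 \<and> (0, x) \<in> T")
    case True
    then obtain x0 where x0: "x0 \<noteq> 0" "(0, x0) \<in> T" by blast
    have base: "(0, x) \<in> T" for x using scale[OF x0(2), of "x / x0"] x0(1) by simp
    show ?thesis
    proof (cases "\<exists>y x. y \<noteq> 0 \<and> (y, x) \<in> T")
      case True
      then obtain y0 x1 where y0: "y0 \<noteq> 0" "(y0, x1) \<in> T" by blast
      have "(y, x) \<in> T" for y x
        using add[OF scale[OF y0(2), of "y / y0"] base[of "x - y / y0 * x1"]] y0(1) by simp
      then have "T = sub2 Full" by auto
      then show ?thesis ..
    next
      case False
      then have "T = sub2 Base" using base by auto
      then show ?thesis ..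
    qed
  next
    case no_base: False
    show ?thesis
    proof (cases "\<exists>y x. y \<noteq> 0 \<and> (y, x) \<in> T")
      case True
      then obtain y0 x1 where y0: "y0 \<noteq> 0" "(y0, x1) \<in> T" by blast
      have "x = x1 / y0 * y" if "(y, x) \<in> T" for y x
      proof -
        have "(0, x - y / y0 * x1) \<in> T"
          using add[OF that scale[OF y0(2), of "- y / y0"]] y0(1) by simp
        with no_base have "x - y / y0 * x1 = 0" by blast
        then show ?thesis by (simp add: mult.commute)
      qed
      moreover have "(y, x1 / y0 * y) \<in> T" for y
        using scale[OF y0(2), of "y / y0"] y0(1) by (simp add: mult.commute)
      ultimately have "T = sub2 (Line (x1 / y0))" by auto
      then show ?thesis ..
    next
      case False
      then have "y = 0 \<and> x = 0" if "(y, x) \<in> T" for y x using no_base that by metis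
      with zero have "T = sub2 Zero" by (auto simp: zero_prod_def)
      then show ?thesis ..
    qed
  qed
  with that show ?thesis by blast
qed

lemma sub2_subset_iff:
  "sub2 l \<subseteq> sub2 m \<longleftrightarrow> l = m \<or> l = Zero \<or> m = (Full :: 'k::field line)"
proof
  assume sub: "sub2 l \<subseteq> sub2 m"
  have "(0, 1) \<in> sub2 l \<Longrightarrow> (0, 1) \<in> sub2 m" "\<And>c. (1, c) \<in> sub2 l \<Longrightarrow> (1, c) \<in> sub2 m"
    using sub by blast+
  \<comment> \<open>Test points (0, 1), (1, 0) and (1, c), where c is the slope of l. If l is not a
    \<open>Line\<close>, then c is one more than the slope of m, so that (1, c) misses the line
    m.\<close>
  note imp = this(1) this(2)[of 0] this(2)[of "case l of Line c \<Rightarrow> c | _ \<Rightarrow> 1 + (case m of Line d \<Rightarrow> d | _ \<Rightarrow> 0)"]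
  show "l = m \<or> l = Zero \<or> m = Full"
    by (cases l; cases m) (use imp in \<open>simp_all add: sub2_mem_iff del: sub2.simps\<close>)
next
  have "sub2 Zero \<subseteq> sub2 m" using sub2_closed(1)[of m] by (simp add: zero_prod_def)
  then show "l = m \<or> l = Zero \<or> m = Full \<Longrightarrow> sub2 l \<subseteq> sub2 m" by auto
qed

section \<open>Stable subspaces of the model\<close>

locale verma_lattice = verma_rot a for a :: "transp \<Rightarrow> 'k::field" +
  assumes slope_ne: "slope a \<noteq> 0"
begin

lemma stableI:
  assumes "0 \<in> U" and "\<And>v w. v \<in> U \<Longrightarrow> w \<in> U \<Longrightarrow> v + w \<in> U"
    and "\<And>c v. v \<in> U \<Longrightarrow> scale c v \<in> U" and "\<And>s v. v \<in> U \<Longrightarrow> act b s v \<in> U"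
  shows "A.stable U"
proof -
  have \<rho>: "\<rho> p v \<in> U" if "v \<in> U" for p v
    using that assms by (induction p arbitrary: v rule: free_algebra_induct) (simp_all add: V.action_simps)
  have "- v \<in> U" if "v \<in> U" for v
    using \<rho>[OF that, of "- 1"] by (simp add: V.action_simps)
  with \<rho> assms(1,2) show ?thesis by (simp add: A.stable_def)
qed

lemma
  assumes "A.stable U"
  shows stable_zero: "0 \<in> U" and stable_add: "v \<in> U \<Longrightarrow> w \<in> U \<Longrightarrow> v + w \<in> U"
    and stable_diff: "v \<in> U \<Longrightarrow> w \<in> U \<Longrightarrow> v - w \<in> U"
    and stable_action: "v \<in> U \<Longrightarrow> \<rho> p v \<in> U"
    and stable_act: "v \<in> U \<Longrightarrow> act b s v \<in> U"
    and stable_scale: "v \<in> U \<Longrightarrow> scale c v \<in> U"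
proof -
  show "0 \<in> U" using assms by (simp add: A.stable_def)
  show add: "v + w \<in> U" if "v \<in> U" "w \<in> U" for v w using assms that by (simp add: A.stable_def)
  show "v - w \<in> U" if "v \<in> U" "w \<in> U" for v w
    using add[of v "- w"] that assms by (simp add: A.stable_def)
  show \<rho>: "\<rho> p v \<in> U" if "v \<in> U" for p v using assms that by (simp add: A.stable_def)
  show "act b s v \<in> U" if "v \<in> U" for s v using \<rho>[OF that, of "letter s"] by (simp add: V.action_simps)
  show "scale c v \<in> U" if "v \<in> U" for c v using \<rho>[OF that, of "const c"] by (simp add: V.action_simps)
qed

definition Ev :: "'k \<times> 'k \<Rightarrow> 'k model" where "Ev e = (0, e, 0, 0)"
definition Wv :: "'k \<times> 'k \<Rightarrow> 'k model" where "Wv w = (0, 0, w, 0)"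
definition Sv :: "'k \<times> 'k \<times> 'k \<times> 'k \<Rightarrow> 'k model" where "Sv q = (0, 0, 0, q)"

lemmas vec_defs = Ev_def Wv_def Sv_def zero_prod_def base_def

text \<open>From x13 x23 m_1 the other three corners of the square are reached by x12, x23 and x12
  x23, each with coefficient 1.\<close>

lemma socle_from_last:
  assumes U: "A.stable U" and "Sv (0, 0, 0, c) \<in> U" "c \<noteq> 0"
  shows "Sv q \<in> U"
proof -
  have 3: "Sv (0, 0, 0, d) \<in> U" for d
    using stable_scale[OF U assms(2), of "d / c"] assms(3) by (simp add: vec_defs)
  have 2: "Sv (0, 0, d, 0) \<in> U" for d
    using stable_act[OF U 3, of "Trans T12" d] by (simp add: vec_defs)
  have 1: "Sv (0, d, 0, 0) \<in> U" for d
    using stable_act[OF U 3, of "Trans T23" d] by (simp add: vec_defs)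
  have 0: "Sv (d, 0, 0, 0) \<in> U" for d
    using stable_act[OF U 1, of "Trans T12" d] by (simp add: vec_defs)
  obtain q0 q1 q2 q3 where "q = (q0, q1, q2, q3)" by (metis prod.exhaust)
  then have "Sv q = Sv (q0, 0, 0, 0) + Sv (0, q1, 0, 0) + Sv (0, 0, q2, 0) + Sv (0, 0, 0, q3)"
    by (simp add: vec_defs)
  then show ?thesis using stable_add[OF U] 0 1 2 3 by simp
qed

lemma socle_from_socle:
  assumes U: "A.stable U" and "Sv (q0, q1, q2, q3) \<in> U" "(q0, q1, q2, q3) \<noteq> 0"
  shows "Sv q \<in> U"
proof -
  note act = stable_act[OF U]
  have 1: ?thesis if "Sv (0, d, 0, 0) \<in> U" "d \<noteq> 0" for d
    by (rule socle_from_last[OF U, of "b * d"])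
      (use act[OF that(1), of "Trans T23"] that(2) slope_ne in \<open>simp_all add: vec_defs\<close>)
  have 2: ?thesis if "Sv (0, 0, d, 0) \<in> U" "d \<noteq> 0" for d
    by (rule socle_from_last[OF U, of "- b * d"])
      (use act[OF that(1), of "Trans T12"] that(2) slope_ne in \<open>simp_all add: vec_defs\<close>)
  have 0: ?thesis if "Sv (d, 0, 0, 0) \<in> U" "d \<noteq> 0" for d
    using act[OF that(1), of "Trans T12"] that(2) slope_ne
    by (intro 1[of "- b * d"]) (simp_all add: vec_defs)
  have "Sv (q0, 0, 0, 0) \<in> U" "Sv (0, q1, 0, 0) \<in> U" "Sv (0, 0, q2, 0) \<in> U" "Sv (0, 0, 0, q3) \<in> U"
    using act[OF assms(2), of "Delta rot"] act[OF assms(2), of "Delta g13"]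
      act[OF assms(2), of "Delta g23"] act[OF assms(2), of "Delta rot'"]
    by (simp_all add: vec_defs)
  with 0 1 2 socle_from_last[OF U] assms(3) show ?thesis by (auto simp: zero_prod_def)
qed

text \<open>A weight projection isolates one corner of the square. The way back to weight (13)(23)
  uses only x12, and x13 out of weight (23), since these steps produce no components in M[e] and
  M[(12)].\<close>

lemma top_weight_from_top:
  assumes U: "A.stable U" and "(p, r) \<in> U" "p \<noteq> 0"
  obtains c q where "c \<noteq> 0" "((c, 0, 0, 0), 0, 0, (q, 0, 0, 0)) \<in> U"
proof -
  note act = stable_act[OF U] and thesisI = that
  obtain p0 p1 p2 p3 y x u w q0 q1 q2 q3 where
    r: "p = (p0, p1, p2, p3)" "r = ((y, x), (u, w), (q0, q1, q2, q3))"
    by (metis prod.exhaust)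
  note v = assms(2)[unfolded r]
  have 2: ?thesis if "((0, 0, c, 0), 0, 0, (0, 0, q, 0)) \<in> U" "c \<noteq> 0" for c q
    using act[OF that(1)[unfolded zero_prod_def], of "Trans T13"] that(2) slope_ne
    by (intro thesisI[of "b * c" "- q"]) (simp_all add: zero_prod_def)
  consider "p0 \<noteq> 0" | "p1 \<noteq> 0" | "p2 \<noteq> 0" | "p3 \<noteq> 0"
    using assms(3) by (auto simp: r zero_prod_def)
  then show ?thesis
  proof cases
    case 1
    then show ?thesis
      using act[OF v, of "Delta rot"] by (intro thesisI[of p0 q0]) (simp_all add: zero_prod_def)
  next
    case 2
    then show ?thesis
      using act[OF act[OF v, of "Delta g13", simplified], of "Trans T12"] slope_ne
      by (intro thesisI[of "- b * p1" q1]) (simp_all add: zero_prod_def)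
  next
    case 3
    then show ?thesis
      using act[OF v, of "Delta g23"] by (intro 2[of p2 q2]) (simp_all add: zero_prod_def)
  next
    case 4
    then show ?thesis
      using act[OF act[OF v, of "Delta rot'", simplified], of "Trans T12"] slope_ne
      by (intro 2[of "- b * p3" q3]) (simp_all add: zero_prod_def)
  qed
qed

lemma socle_subset:
  assumes U: "A.stable U" and "v \<in> U" "v \<noteq> 0"
  shows "Sv q \<in> U"
proof -
  note act = stable_act[OF U]
  obtain p0 p1 p2 p3 y x u w q0 q1 q2 q3 where
    v: "v = ((p0, p1, p2, p3), (y, x), (u, w), (q0, q1, q2, q3))"
    by (metis prod.exhaust)
  note vU = assms(2)[unfolded v]
  show ?thesis
  proof (cases "(p0, p1, p2, p3) = 0")
    case False
    from top_weight_from_top[OF U vU False]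
    obtain c d where cd: "c \<noteq> 0" "((c, 0, 0, 0), 0, 0, (d, 0, 0, 0)) \<in> U" .
    \<comment> \<open>x13 x23 takes m_1 to the last socle vector, and x23 kills the socle vector of
      weight (13)(23), so the unknown d disappears.\<close>
    from act[OF act[OF cd(2)[unfolded zero_prod_def], of "Trans T23", simplified], of "Trans T13"]
    have "Sv (0, 0, 0, c) \<in> U" by (simp add: vec_defs)
    from socle_from_last[OF U this cd(1)] show ?thesis .
  next
    case True
    then have p: "p0 = 0" "p1 = 0" "p2 = 0" "p3 = 0" by (simp_all add: zero_prod_def)
    note vU = vU[unfolded p]
    have E: "Ev (y, x) \<in> U" and W: "Wv (u, w) \<in> U"
      using act[OF vU, of "Delta 1"] act[OF vU, of "Delta g12"] by (simp_all add: vec_defs)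
    have S: "Sv (q0, q1, q2, q3) \<in> U"
      using stable_diff[OF U stable_diff[OF U vU E] W] by (simp add: vec_defs)
    have S': "Sv (0, - x, 0, 0) \<in> U" "Sv (0, 0, y - x, 0) \<in> U" "Sv (w, 0, 0, 0) \<in> U"
      "Sv (0, 0, 0, u + b * w) \<in> U"
      using act[OF E[unfolded vec_defs], of "Trans T13"] act[OF E[unfolded vec_defs], of "Trans T23"]
        act[OF W[unfolded vec_defs], of "Trans T23"] act[OF W[unfolded vec_defs], of "Trans T13"]
      by (simp_all add: vec_defs)
    \<comment> \<open>x and y - x are coordinates on M[e], w and u + b w on M[(12)]; hence a nonzero
      component in a plane has a nonzero image in the socle.\<close>
    have "(q0, q1, q2, q3) \<noteq> 0 \<or> x \<noteq> 0 \<or> y - x \<noteq> 0 \<or> w \<noteq> 0 \<or> u + b * w \<noteq> 0"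
      using assms(3) by (auto simp: v p zero_prod_def)
    with socle_from_socle[OF U S, of q] S'[THEN socle_from_socle[OF U, of _ _ _ _ q]] show ?thesis
      by (cases "w = 0") (auto simp: zero_prod_def)
  qed
qed

text \<open>The weight space of (13)(23) is spanned by m_1 and a socle vector. Since U contains the
  socle, subtraction leaves a nonzero multiple of m_1, which generates everything.\<close>

lemma stable_eq_UNIV:
  assumes U: "A.stable U" and "v \<in> U" "fst v \<noteq> 0"
  shows "U = UNIV"
proof -
  obtain c d where cd: "c \<noteq> 0" "((c, 0, 0, 0), 0, 0, (d, 0, 0, 0)) \<in> U"
    using top_weight_from_top[OF U, of "fst v" "snd v"] assms(2,3) by auto
  have "v \<noteq> 0" using assms(3) by auto
  from stable_diff[OF U cd(2) socle_subset[OF U assms(2) this, of "(d, 0, 0, 0)"]]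
  have "((c, 0, 0, 0), 0, 0, 0) \<in> U" by (simp add: vec_defs)
  from stable_scale[OF U this[unfolded zero_prod_def], of "inverse c"] cd(1)
  have "base \<in> U" by (simp add: base_def)
  then have "\<rho> (lift v) base \<in> U" for v by (rule stable_action[OF U])
  then show ?thesis by (auto simp: action_lift)
qed

text \<open>The last component is unrestricted because nonzero stable subspaces contain the socle;
  the first is zero because otherwise nothing proper remains.\<close>

definition K2 :: "'k line \<Rightarrow> 'k line \<Rightarrow> 'k model set" where
  "K2 E W = {v. fst v = 0 \<and> fst (snd v) \<in> sub2 E \<and> fst (snd (snd v)) \<in> sub2 W}"

lemma K2_iff: "(p, e, w, q) \<in> K2 E W \<longleftrightarrow> p = 0 \<and> e \<in> sub2 E \<and> w \<in> sub2 W"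
  by (simp add: K2_def)

definition pairs :: "('k line \<times> 'k line) set" where
  "pairs = {(Zero, Zero), (Zero, Base), (Base, Zero), (Base, Base), (Base, Full), (Full, Base), (Full, Full)}
     \<union> range (\<lambda>c. (Line c, Base)) \<union> range (\<lambda>c. (Base, Line c))"

lemma stable_K2_imp:
  assumes U: "A.stable (K2 E W)"
  shows "(y, x) \<in> sub2 E \<Longrightarrow> (0, y) \<in> sub2 W" "(u, w) \<in> sub2 W \<Longrightarrow> (0, u) \<in> sub2 E"
proof -
  show "(0, y) \<in> sub2 W" if "(y, x) \<in> sub2 E"
    using stable_act[OF U, of "((0, 0, 0, 0), (y, x), (0, 0), (0, 0, 0, 0))" "Trans T12"] that
    by (simp add: K2_iff zero_prod_def sub2_closed)
  show "(0, u) \<in> sub2 E" if "(u, w) \<in> sub2 W"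
    using stable_act[OF U, of "((0, 0, 0, 0), (0, 0), (u, w), (0, 0, 0, 0))" "Trans T12"] that
    by (simp add: K2_iff zero_prod_def sub2_closed)
qed

text \<open>A vector off the second axis in either plane forces, through x12, the second axis of the
  other plane. Thus a \<open>Line\<close> can only be paired with \<open>Base\<close>.\<close>

lemma stable_K2_iff: "A.stable (K2 E W) \<longleftrightarrow> (E, W) \<in> pairs"
proof
  assume U: "A.stable (K2 E W)"
  note imp = stable_K2_imp[OF U]
  have "(1, c) \<in> sub2 E \<Longrightarrow> (0, 1) \<in> sub2 W" "(1, c) \<in> sub2 W \<Longrightarrow> (0, 1) \<in> sub2 E" for c
    using imp[of 1 c] by simp_all
  then show "(E, W) \<in> pairs"
    by (cases E; cases W) (auto simp: pairs_def sub2_mem_iff simp del: sub2.simps)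
next
  assume "(E, W) \<in> pairs"
  then have imp: "(0, y) \<in> sub2 W" "(0, u) \<in> sub2 E" if "(y, x) \<in> sub2 E" "(u, w) \<in> sub2 W" for y x u w
    using that by (auto simp: pairs_def sub2_mem_iff simp del: sub2.simps)
  show "A.stable (K2 E W)"
  proof (rule stableI)
    fix s v assume "v \<in> K2 E W"
    then obtain e w q where v: "v = (0, e, w, q)" "e \<in> sub2 E" "w \<in> sub2 W"
      by (cases v) (auto simp: K2_iff)
    obtain y x u z q0 q1 q2 q3 where e: "e = (y, x)" "w = (u, z)" "q = (q0, q1, q2, q3)"
      by (metis prod.exhaust)
    show "act b s v \<in> K2 E W"
      using v(2,3) imp[of y x u z]
      by (cases s rule: generator_cases) (auto simp: v(1) e K2_iff zero_prod_def sub2_closed)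
  qed (auto simp: K2_iff zero_prod_def sub2_closed)
qed

lemma K2_subsetI:
  assumes U: "A.stable U" and "v \<in> U" "v \<noteq> 0"
    and "\<And>e. e \<in> sub2 E \<Longrightarrow> Ev e \<in> U" "\<And>w. w \<in> sub2 W \<Longrightarrow> Wv w \<in> U"
  shows "K2 E W \<subseteq> U"
proof
  fix v' assume "v' \<in> K2 E W"
  then obtain e w q where v': "v' = (0, e, w, q)" "e \<in> sub2 E" "w \<in> sub2 W"
    by (cases v') (auto simp: K2_iff)
  then have "v' = Ev e + Wv w + Sv q" by (simp add: vec_defs(1-3))
  then show "v' \<in> U" using stable_add[OF U] assms(4,5) v'(2,3) socle_subset[OF U assms(2,3)] by simp
qed

text \<open>The projections \<delta>_e and \<delta>_(12) keep the plane components inside U, so U is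
  recovered from its intersections with the two planes and the socle.\<close>

lemma stable_classification:
  assumes U: "A.stable U" "U \<noteq> {0}" "U \<noteq> UNIV"
  obtains E W where "(E, W) \<in> pairs" "U = K2 E W"
proof -
  note act = stable_act[OF U(1)]
  obtain v0 where v0: "v0 \<in> U" "v0 \<noteq> 0" using U stable_zero[OF U(1)] by blast
  have top: "p = 0" if "(p, r) \<in> U" for p r using stable_eq_UNIV[OF U(1) that] U(3) by auto
  have E_U: "Ev e \<in> U" and W_U: "Wv w \<in> U" if v: "(0, e, w, q) \<in> U" for e w q
  proof -
    obtain y x u z q0 q1 q2 q3 where e: "e = (y, x)" "w = (u, z)" "q = (q0, q1, q2, q3)"
      by (metis prod.exhaust)
    show "Ev e \<in> U" "Wv w \<in> U"
      using act[OF v[unfolded e zero_prod_def], of "Delta 1"] act[OF v[unfolded e zero_prod_def], of "Delta g12"]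
      by (simp_all add: e vec_defs)
  qed
  obtain E where E: "{e. Ev e \<in> U} = sub2 E"
  proof (rule sub2_surj[of "{e. Ev e \<in> U}"])
    show "(y + y', x + x') \<in> {e. Ev e \<in> U}"
      if "(y, x) \<in> {e. Ev e \<in> U}" "(y', x') \<in> {e. Ev e \<in> U}" for y x y' x'
      using stable_add[OF U(1), of "Ev (y, x)" "Ev (y', x')"] that by (simp add: vec_defs)
    show "(c * y, c * x) \<in> {e. Ev e \<in> U}" if "(y, x) \<in> {e. Ev e \<in> U}" for c y x
      using stable_scale[OF U(1), of "Ev (y, x)" c] that by (simp add: vec_defs)
  qed (use stable_zero[OF U(1)] in \<open>auto simp: vec_defs\<close>)
  obtain W where W: "{w. Wv w \<in> U} = sub2 W"
  proof (rule sub2_surj[of "{w. Wv w \<in> U}"])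
    show "(y + y', x + x') \<in> {e. Wv e \<in> U}"
      if "(y, x) \<in> {e. Wv e \<in> U}" "(y', x') \<in> {e. Wv e \<in> U}" for y x y' x'
      using stable_add[OF U(1), of "Wv (y, x)" "Wv (y', x')"] that by (simp add: vec_defs)
    show "(c * y, c * x) \<in> {e. Wv e \<in> U}" if "(y, x) \<in> {e. Wv e \<in> U}" for c y x
      using stable_scale[OF U(1), of "Wv (y, x)" c] that by (simp add: vec_defs)
  qed (use stable_zero[OF U(1)] in \<open>auto simp: vec_defs\<close>)
  have "U = K2 E W"
  proof
    show "K2 E W \<subseteq> U" by (rule K2_subsetI[OF U(1) v0]) (use E W in auto)
    show "U \<subseteq> K2 E W"
    proof
      fix v assume v: "v \<in> U"
      obtain p e w q where v': "v = (p, e, w, q)" by (metis prod.exhaust)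
      then have "p = 0" using top v by simp
      with v v' have "Ev e \<in> U" "Wv w \<in> U" using E_U W_U by blast+
      with \<open>p = 0\<close> show "v \<in> K2 E W" by (simp add: v' K2_iff flip: E W)
    qed
  qed
  moreover from this have "(E, W) \<in> pairs" using U(1) by (simp add: stable_K2_iff)
  ultimately show ?thesis using that by blast
qed

lemma K2_subset_iff: "K2 E W \<subseteq> K2 E' W' \<longleftrightarrow> sub2 E \<subseteq> sub2 E' \<and> sub2 W \<subseteq> sub2 W'"
proof
  assume sub: "K2 E W \<subseteq> K2 E' W'"
  have 0: "0 \<in> sub2 l" for l :: "'k line" using sub2_closed(1)[of l] by (simp add: zero_prod_def)
  show "sub2 E \<subseteq> sub2 E' \<and> sub2 W \<subseteq> sub2 W'"
  proof (intro conjI subsetI)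
    fix e assume "e \<in> sub2 E"
    then have "(0, e, 0, 0) \<in> K2 E W" by (simp add: K2_iff 0)
    from subsetD[OF sub this] show "e \<in> sub2 E'" by (simp add: K2_iff)
  next
    fix w assume "w \<in> sub2 W"
    then have "(0, 0, w, 0) \<in> K2 E W" by (simp add: K2_iff 0)
    from subsetD[OF sub this] show "w \<in> sub2 W'" by (simp add: K2_iff)
  qed
qed (auto simp: K2_def)

section \<open>The proper nonzero submodules\<close>

definition N :: "'k line \<Rightarrow> 'k line \<Rightarrow> (('k F set \<times> 'k) \<Rightarrow>\<^sub>0 int) set set" where
  "N E W = \<Psi> ` K2 E W"

lemma N_subset_iff: "N E W \<subseteq> N E' W' \<longleftrightarrow> (E = E' \<or> E = Zero \<or> E' = Full) \<and> (W = W' \<or> W = Zero \<or> W' = Full)"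
  by (simp add: N_def inj_image_subset_iff[OF A.inj_\<Psi>] K2_subset_iff sub2_subset_iff)

lemma N_eq_iff: "N E W = N E' W' \<longleftrightarrow> E = E' \<and> W = W'"
  by (auto simp: set_eq_subset N_subset_iff)

lemma proper_submodules:
  "{U. submodule U (alg a) (Ver a) \<and> U \<noteq> {\<zero>\<^bsub>Ver a\<^esub>} \<and> U \<noteq> carrier (Ver a)} = case_prod N ` pairs"
proof (intro equalityI subsetI)
  fix U assume "U \<in> {U. submodule U (alg a) (Ver a) \<and> U \<noteq> {\<zero>\<^bsub>Ver a\<^esub>} \<and> U \<noteq> carrier (Ver a)}"
  then have U: "submodule U (alg a) (Ver a)" and ne: "U \<noteq> {\<Psi> 0}" "U \<noteq> range \<Psi>"
    by (simp_all add: A.\<Psi>_zero A.carrier_M)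
  from U obtain U' where U': "A.stable U'" "U = \<Psi> ` U'" unfolding A.submodule_iff by blast
  from ne have "U' \<noteq> {0}" "U' \<noteq> UNIV" by (auto simp: U'(2))
  from stable_classification[OF U'(1) this] obtain E W where "(E, W) \<in> pairs" "U' = K2 E W" .
  then show "U \<in> case_prod N ` pairs" by (force simp: N_def U'(2))
next
  fix U assume "U \<in> case_prod N ` pairs"
  then obtain E W where U: "(E, W) \<in> pairs" "U = \<Psi> ` K2 E W" by (auto simp: N_def)
  have "Sv (1, 0, 0, 0) \<in> K2 E W" "Sv (1, 0, 0, 0) \<noteq> 0" "base \<notin> K2 E W"
    by (simp_all add: vec_defs K2_iff sub2_closed)
  then have "K2 E W \<noteq> {0}" "K2 E W \<noteq> UNIV" by blast+
  moreover have "\<Psi> ` V = \<Psi> ` V' \<longleftrightarrow> V = V'" for V V' by (rule inj_image_eq_iff[OF A.inj_\<Psi>])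
  from this[of _ "{0}"] this[of _ UNIV] have "\<Psi> ` V = {\<Psi> 0} \<longleftrightarrow> V = {0}" "\<Psi> ` V = range \<Psi> \<longleftrightarrow> V = UNIV" for V
    by simp_all
  ultimately show "U \<in> {U. submodule U (alg a) (Ver a) \<and> U \<noteq> {\<zero>\<^bsub>Ver a\<^esub>} \<and> U \<noteq> carrier (Ver a)}"
    using U(1) by (simp add: U(2) A.submodule_image_iff stable_K2_iff A.\<Psi>_zero A.carrier_M)
qed

subsection \<open>The generators of the submodules\<close>

lemma mvec_eq: "mvec a ts = \<Psi> (\<rho> (prod_list (map x\<^sub>F ts)) base)"
  by (simp add: mvec_def verma_vec_eq tens_eq_\<Psi> flip: rot_def)

lemma mvec_12_23: "mvec a [T12, T23] = \<Psi> (Ev (0, 1))"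
  by (simp add: mvec_eq V.action_simps vec_defs)

lemma m_o_eq: "m_o a = \<Psi> (Wv (0, 1))"
  by (simp add: m_o_def mvec_eq V.action_simps vec_defs S.\<Psi>_smult A.\<Psi>_add f_fun_table[OF a_eq])

text \<open>The table gives m_top = b^2 m_1 + x12 x23 x13 x23 m_1, and f_13((23)) f_23((13)) = b^2
  is exactly the multiple of m_1 to be removed.\<close>

lemma m_soc_eq: "m_soc a = \<Psi> (Sv (- 1, 0, 0, 0))"
  by (simp add: m_soc_def m_top_def mvec_eq V.action_simps vec_defs S.\<Psi>_smult A.a_minus_\<Psi>
      f_fun_table[OF a_eq])

lemma Ver_wt_eq: "Ver_wt a g = \<Psi> ` range (act b (Delta g))"
  by (simp add: Ver_wt_def weight_space_def A.carrier_M image_image A.\<Psi>_smult V.action_letter)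

lemma Ver_wt_1: "Ver_wt a 1 = \<Psi> ` range Ev"
proof -
  have "range (act b (Delta 1)) = range Ev"
  proof (intro equalityI subsetI)
    fix v assume "v \<in> range (act b (Delta 1))"
    then obtain v' where v': "v = act b (Delta 1) v'" by blast
    show "v \<in> range Ev" unfolding v' by (cases v') (auto simp: vec_defs)
  next
    fix v assume "v \<in> range Ev"
    then have "v = act b (Delta 1) v" by (auto simp: vec_defs)
    then show "v \<in> range (act b (Delta 1))" by blast
  qed
  then show ?thesis by (simp add: Ver_wt_eq)
qed

lemma Ver_wt_s12: "Ver_wt a g12 = \<Psi> ` range Wv"
proof -
  have "range (act b (Delta g12)) = range Wv"
  proof (intro equalityI subsetI)
    fix v assume "v \<in> range (act b (Delta g12))"
    then obtain v' where v': "v = act b (Delta g12) v'" by blast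
    show "v \<in> range Wv" unfolding v' by (cases v') (auto simp: vec_defs)
  next
    fix v assume "v \<in> range Wv"
    then have "v = act b (Delta g12) v" by (auto simp: vec_defs)
    then show "v \<in> range (act b (Delta g12))" by blast
  qed
  then show ?thesis by (simp add: Ver_wt_eq)
qed

lemma span_Ver_insert:
  "span_Ver a {\<Psi> v, \<Psi> w} = \<Psi> ` {scale c v + scale d w | c d. True}" (is "_ = _ ` ?U")
proof -
  have neg: "- v = scale (- 1) v" for v :: "'k model" by (cases v) auto
  have "S.stable ?U"
    unfolding S.stable_def
  proof (intro conjI ballI allI)
    show "0 \<in> ?U" by (auto intro!: exI[of _ 0] simp: V.sc_zero_left)
    show "x + y \<in> ?U" if "x \<in> ?U" "y \<in> ?U" for x y
    proof -
      obtain c d c' d' where "x = scale c v + scale d w" "y = scale c' v + scale d' w" using \<open>x \<in> ?U\<close> \<open>y \<in> ?U\<close> by blast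
      then have "x + y = scale (c + c') v + scale (d + d') w" by (simp add: V.sc_add_left algebra_simps)
      then show ?thesis by blast
    qed
    show sc: "scale e x \<in> ?U" if "x \<in> ?U" for e x
    proof -
      obtain c d where "x = scale c v + scale d w" using \<open>x \<in> ?U\<close> by blast
      then have "scale e x = scale (e * c) v + scale (e * d) w" by (simp add: V.sc_add_right V.sc_sc)
      then show ?thesis by blast
    qed
    show "- x \<in> ?U" if "x \<in> ?U" for x using sc[OF that, of "- 1"] by (simp only: neg)
  qed
  moreover have "v = scale 1 v + scale 0 w" "w = scale 0 v + scale 1 w"
    by (simp_all add: V.sc_one V.sc_zero_left)
  then have "{v, w} \<subseteq> ?U" by blast
  ultimately have "generated_submodule ring_of_type_algebra (scalars a (Ver a)) (\<Psi> ` {v, w}) = \<Psi> ` ?U"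
    by (rule S.generated_submodule_eqI) (auto simp: S.stable_def)
  then show ?thesis by (simp add: span_Ver_def linear_span_def)
qed

lemma span_Ver_singleton: "span_Ver a {\<Psi> v} = \<Psi> ` range (\<lambda>c. scale c v)"
proof -
  have "{scale c v + scale d v | c d. True} = range (\<lambda>c. scale c v)"
  proof (intro equalityI subsetI)
    fix x assume "x \<in> range (\<lambda>c. scale c v)"
    then obtain c where "x = scale c v + scale 0 v" by (auto simp: V.sc_zero_left)
    then show "x \<in> {scale c v + scale d v | c d. True}" by blast
  qed (auto simp flip: V.sc_add_left)
  then show ?thesis using span_Ver_insert[of v v] by simp
qed

lemma v_set_eq: "v_set a = {\<Psi> (Ev (y, x)) | y x. y \<noteq> 0}"
proof -
  have "range Ev = {scale c (Ev (y, x)) + scale d (Ev (0, 1)) | c d. True} \<longleftrightarrow> y \<noteq> 0" for y x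
  proof
    assume "range Ev = {scale c (Ev (y, x)) + scale d (Ev (0, 1)) | c d. True}"
    moreover have "Ev (1, 0) \<in> range Ev" by blast
    ultimately have "Ev (1, 0) \<in> {scale c (Ev (y, x)) + scale d (Ev (0, 1)) | c d. True}" by simp
    then show "y \<noteq> 0" by (auto simp: vec_defs)
  next
    assume y: "y \<noteq> 0"
    \<comment> \<open>Triangular system: the first coordinate fixes the coefficient of v, the second
      that of m_(12)(23).\<close>
    have "Ev (y', x') = scale (y' / y) (Ev (y, x)) + scale (x' - y' / y * x) (Ev (0, 1))" for y' x'
      using y by (simp add: vec_defs)
    then have "Ev e \<in> {scale c (Ev (y, x)) + scale d (Ev (0, 1)) | c d. True}" for e
      by (cases e) blast
    then show "range Ev = {scale c (Ev (y, x)) + scale d (Ev (0, 1)) | c d. True}"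
      by (intro equalityI) (auto simp: vec_defs)
  qed
  then have span: "\<Psi> ` range Ev = span_Ver a {\<Psi> (Ev (y, x)), \<Psi> (Ev (0, 1))} \<longleftrightarrow> y \<noteq> 0" for y x
    by (simp only: span_Ver_insert inj_image_eq_iff[OF A.inj_\<Psi>])
  show ?thesis
  proof (intro equalityI subsetI)
    fix m assume "m \<in> v_set a"
    then have m: "m \<in> \<Psi> ` range Ev" "\<Psi> ` range Ev = span_Ver a {m, \<Psi> (Ev (0, 1))}"
      unfolding v_set_def Ver_wt_1 mvec_12_23 by blast+
    from m(1) obtain y x where eq: "m = \<Psi> (Ev (y, x))" by (metis imageE surj_pair)
    have "y \<noteq> 0" using m(2) unfolding eq span .
    with eq show "m \<in> {\<Psi> (Ev (y, x)) | y x. y \<noteq> 0}" by blast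
  next
    fix m assume "m \<in> {\<Psi> (Ev (y, x)) | y x. y \<noteq> 0}"
    then obtain y x where "m = \<Psi> (Ev (y, x))" "y \<noteq> 0" by blast
    then show "m \<in> v_set a" using span by (simp add: v_set_def Ver_wt_1 mvec_12_23)
  qed
qed

lemma w_set_eq: "w_set a = {\<Psi> (Wv (u, w)) | u w. u \<noteq> 0}"
proof -
  have "range Wv = {scale c (Wv (u, w)) + scale d (Wv (0, 1)) | c d. True} \<longleftrightarrow> u \<noteq> 0" for u w
  proof
    assume "range Wv = {scale c (Wv (u, w)) + scale d (Wv (0, 1)) | c d. True}"
    moreover have "Wv (1, 0) \<in> range Wv" by blast
    ultimately have "Wv (1, 0) \<in> {scale c (Wv (u, w)) + scale d (Wv (0, 1)) | c d. True}" by simp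
    then show "u \<noteq> 0" by (auto simp: vec_defs)
  next
    assume u: "u \<noteq> 0"
    have "Wv (u', w') = scale (u' / u) (Wv (u, w)) + scale (w' - u' / u * w) (Wv (0, 1))" for u' w'
      using u by (simp add: vec_defs)
    then have "Wv e \<in> {scale c (Wv (u, w)) + scale d (Wv (0, 1)) | c d. True}" for e
      by (cases e) blast
    then show "range Wv = {scale c (Wv (u, w)) + scale d (Wv (0, 1)) | c d. True}"
      by (intro equalityI) (auto simp: vec_defs)
  qed
  then have span: "\<Psi> ` range Wv = span_Ver a {\<Psi> (Wv (u, w)), \<Psi> (Wv (0, 1))} \<longleftrightarrow> u \<noteq> 0" for u w
    by (simp only: span_Ver_insert inj_image_eq_iff[OF A.inj_\<Psi>])
  show ?thesis
  proof (intro equalityI subsetI)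
    fix m assume "m \<in> w_set a"
    then have m: "m \<in> \<Psi> ` range Wv" "\<Psi> ` range Wv = span_Ver a {m, \<Psi> (Wv (0, 1))}"
      unfolding w_set_def Ver_wt_s12 m_o_eq by blast+
    from m(1) obtain u w where eq: "m = \<Psi> (Wv (u, w))" by (metis imageE surj_pair)
    have "u \<noteq> 0" using m(2) unfolding eq span .
    with eq show "m \<in> {\<Psi> (Wv (u, w)) | u w. u \<noteq> 0}" by blast
  next
    fix m assume "m \<in> {\<Psi> (Wv (u, w)) | u w. u \<noteq> 0}"
    then obtain u w where "m = \<Psi> (Wv (u, w))" "u \<noteq> 0" by blast
    then show "m \<in> w_set a" using span by (simp add: w_set_def Ver_wt_s12 m_o_eq)
  qed
qed

text \<open>The nonzero member v of S supplies the socle, so only the vectors in the two planes have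
  to be produced from S.\<close>

lemma subm_eqI:
  assumes "(E, W) \<in> pairs" "S \<subseteq> K2 E W" "v \<in> S" "v \<noteq> 0"
    and "\<And>U e. A.stable U \<Longrightarrow> S \<subseteq> U \<Longrightarrow> e \<in> sub2 E \<Longrightarrow> Ev e \<in> U"
    and "\<And>U w. A.stable U \<Longrightarrow> S \<subseteq> U \<Longrightarrow> w \<in> sub2 W \<Longrightarrow> Wv w \<in> U"
  shows "subm a (\<Psi> ` S) = N E W"
  unfolding subm_def N_def
proof (rule A.generated_submodule_eqI)
  show "K2 E W \<subseteq> U" if "A.stable U" "S \<subseteq> U" for U
    by (rule K2_subsetI[OF that(1)]) (use assms that in auto)
qed (simp_all add: assms stable_K2_iff)

lemma
  assumes U: "A.stable U"
  shows Ev_Zero: "e \<in> sub2 Zero \<Longrightarrow> Ev e \<in> U"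
    and Wv_Zero: "w \<in> sub2 Zero \<Longrightarrow> Wv w \<in> U"
    and Ev_Base: "Ev (0, c) \<in> U \<Longrightarrow> c \<noteq> 0 \<Longrightarrow> e \<in> sub2 Base \<Longrightarrow> Ev e \<in> U"
    and Wv_Base: "Wv (0, c) \<in> U \<Longrightarrow> c \<noteq> 0 \<Longrightarrow> w \<in> sub2 Base \<Longrightarrow> Wv w \<in> U"
    and Ev_Line: "Ev (y, x) \<in> U \<Longrightarrow> y \<noteq> 0 \<Longrightarrow> e \<in> sub2 (Line (x / y)) \<Longrightarrow> Ev e \<in> U"
    and Wv_Line: "Wv (y, x) \<in> U \<Longrightarrow> y \<noteq> 0 \<Longrightarrow> w \<in> sub2 (Line (x / y)) \<Longrightarrow> Wv w \<in> U"
    and x12_Ev: "Ev (y, x) \<in> U \<Longrightarrow> Wv (0, y) \<in> U"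
    and x12_Wv: "Wv (y, x) \<in> U \<Longrightarrow> Ev (0, y) \<in> U"
proof -
  show "e \<in> sub2 Zero \<Longrightarrow> Ev e \<in> U" "w \<in> sub2 Zero \<Longrightarrow> Wv w \<in> U"
    using stable_zero[OF U] by (auto simp: vec_defs)
  show "Ev (0, c) \<in> U \<Longrightarrow> c \<noteq> 0 \<Longrightarrow> e \<in> sub2 Base \<Longrightarrow> Ev e \<in> U"
    using stable_scale[OF U, of "Ev (0, c)" "snd e / c"] by (auto simp: vec_defs)
  show "Wv (0, c) \<in> U \<Longrightarrow> c \<noteq> 0 \<Longrightarrow> w \<in> sub2 Base \<Longrightarrow> Wv w \<in> U"
    using stable_scale[OF U, of "Wv (0, c)" "snd w / c"] by (auto simp: vec_defs)
  show "Ev (y, x) \<in> U \<Longrightarrow> y \<noteq> 0 \<Longrightarrow> e \<in> sub2 (Line (x / y)) \<Longrightarrow> Ev e \<in> U"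
    using stable_scale[OF U, of "Ev (y, x)" "fst e / y"] by (auto simp: vec_defs mult.commute)
  show "Wv (y, x) \<in> U \<Longrightarrow> y \<noteq> 0 \<Longrightarrow> w \<in> sub2 (Line (x / y)) \<Longrightarrow> Wv w \<in> U"
    using stable_scale[OF U, of "Wv (y, x)" "fst w / y"] by (auto simp: vec_defs mult.commute)
  show "Ev (y, x) \<in> U \<Longrightarrow> Wv (0, y) \<in> U"
    using stable_act[OF U, of "Ev (y, x)" "Trans T12"] by (simp add: vec_defs)
  show "Wv (y, x) \<in> U \<Longrightarrow> Ev (0, y) \<in> U"
    using stable_act[OF U, of "Wv (y, x)" "Trans T12"] by (simp add: vec_defs)
qed

lemma zero_mem_sub2: "0 \<in> sub2 l"
  using sub2_closed(1)[of l] by (simp add: zero_prod_def)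

lemma mem_K2:
  "Ev e \<in> K2 E W \<longleftrightarrow> e \<in> sub2 E" "Wv w \<in> K2 E W \<longleftrightarrow> w \<in> sub2 W" "Sv q \<in> K2 E W"
  "Ev e + Wv w \<in> K2 E W \<longleftrightarrow> e \<in> sub2 E \<and> w \<in> sub2 W"
  by (simp_all add: vec_defs(1-3) K2_iff zero_mem_sub2)

lemma pair_eq_0: "(x, y) = 0 \<longleftrightarrow> x = 0 \<and> y = 0"
  by (simp add: zero_prod_def)

lemma vec_eq_0: "Ev e = 0 \<longleftrightarrow> e = 0" "Wv w = 0 \<longleftrightarrow> w = 0" "Sv q = 0 \<longleftrightarrow> q = 0"
  by (auto simp: vec_defs(1-3) zero_prod_def)

lemma pairsI [simp]:
  "(Zero, Zero) \<in> pairs" "(Zero, Base) \<in> pairs" "(Base, Zero) \<in> pairs" "(Base, Base) \<in> pairs"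
  "(Base, Full) \<in> pairs" "(Full, Base) \<in> pairs" "(Full, Full) \<in> pairs"
  "(Line c, Base) \<in> pairs" "(Base, Line c) \<in> pairs"
  by (simp_all add: pairs_def)

lemma N_1323_eq: "N_1323 a = N Full Full"
proof -
  have "Ver_wt a 1 <+>\<^bsub>Ver a\<^esub> Ver_wt a g12 = \<Psi> ` {Ev e + Wv w | e w. True}"
  proof -
    have "Ver_wt a 1 <+>\<^bsub>Ver a\<^esub> Ver_wt a g12 = (\<Union>e. \<Union>w. {\<Psi> (Ev e + Wv w)})"
      by (simp add: set_add_def set_mult_def Ver_wt_1 Ver_wt_s12 A.\<Psi>_add)
    then show ?thesis by blast
  qed
  moreover have "subm a (\<Psi> ` {Ev e + Wv w | e w. True}) = N Full Full"
  proof (rule subm_eqI[where v = "Ev (1, 0) + Wv 0"])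
    fix U assume U: "{Ev e + Wv w | e w. True} \<subseteq> U"
    have "Ev e + Wv 0 \<in> U" "Ev 0 + Wv e \<in> U" for e using U by blast+
    then show "Ev e \<in> U" "Wv e \<in> U" for e by (simp_all add: vec_eq_0[THEN iffD2])
  next
    show "Ev (1, 0) + Wv 0 \<in> {Ev e + Wv w | e w. True}" by blast
    show "Ev (1, 0) + Wv 0 \<noteq> 0" by (simp add: vec_defs)
  qed (auto simp: mem_K2)
  ultimately show ?thesis by (simp add: N_1323_def)
qed

text \<open>M[e] contributes to weight (12) only through x12, whose image is the line of
  m_o.\<close>

lemma subm_Ver_wt_1: "subm a (Ver_wt a 1) = N Full Base"
  unfolding Ver_wt_1
proof (rule subm_eqI[where v = "Ev (1, 0)"])
  fix U and w :: "'k \<times> 'k" assume U: "A.stable U" "range Ev \<subseteq> U" and "w \<in> sub2 Base"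
  then show "Wv w \<in> U" using Wv_Base[OF U(1) x12_Ev[OF U(1), of 1 0]] by auto
qed (auto simp: mem_K2 vec_eq_0 pair_eq_0)

lemma subm_Ver_wt_s12: "subm a (Ver_wt a g12) = N Base Full"
  unfolding Ver_wt_s12
proof (rule subm_eqI[where v = "Wv (1, 0)"])
  fix U and w :: "'k \<times> 'k" assume U: "A.stable U" "range Wv \<subseteq> U" and "w \<in> sub2 Base"
  then show "Ev w \<in> U" using Ev_Base[OF U(1) x12_Wv[OF U(1), of 1 0]] by auto
qed (auto simp: mem_K2 vec_eq_0 pair_eq_0)

lemma subm_span_m_o: "subm a (span_Ver a {m_o a, mvec a [T12, T23]}) = N Base Base"
  unfolding m_o_eq mvec_12_23 span_Ver_insert
proof (rule subm_eqI[where v = "scale 1 (Wv (0, 1)) + scale 0 (Ev (0, 1))"])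
  fix U and w :: "'k \<times> 'k" assume U: "A.stable U" "{scale c (Wv (0, 1)) + scale d (Ev (0, 1)) | c d. True} \<subseteq> U"
    and w: "w \<in> sub2 Base"
  have "scale 1 (Wv (0, 1)) + scale 0 (Ev (0, 1)) \<in> U" "scale 0 (Wv (0, 1)) + scale 1 (Ev (0, 1)) \<in> U"
    using U(2) by blast+
  then have "Wv (0, 1) \<in> U" "Ev (0, 1) \<in> U" by (simp_all add: vec_defs)
  with w show "Ev w \<in> U" "Wv w \<in> U" using Ev_Base[OF U(1)] Wv_Base[OF U(1)] by (simp_all del: sub2.simps)
qed (auto simp: vec_defs K2_iff)

lemma subm_m_o: "subm a {m_o a} = N Zero Base"
proof -
  have "subm a (\<Psi> ` {Wv (0, 1)}) = N Zero Base"
    by (rule subm_eqI[where v = "Wv (0, 1)"])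
      (simp_all add: mem_K2 vec_eq_0 pair_eq_0 sub2_mem_iff Ev_Zero Wv_Base[of _ 1] del: sub2.simps)
  then show ?thesis by (simp add: m_o_eq)
qed

lemma subm_mvec_12_23: "subm a {mvec a [T12, T23]} = N Base Zero"
proof -
  have "subm a (\<Psi> ` {Ev (0, 1)}) = N Base Zero"
    by (rule subm_eqI[where v = "Ev (0, 1)"])
      (simp_all add: mem_K2 vec_eq_0 pair_eq_0 sub2_mem_iff Wv_Zero Ev_Base[of _ 1] del: sub2.simps)
  then show ?thesis by (simp add: mvec_12_23)
qed

lemma subm_m_soc: "subm a {m_soc a} = N Zero Zero"
proof -
  have "subm a (\<Psi> ` {Sv (- 1, 0, 0, 0)}) = N Zero Zero"
    by (rule subm_eqI[where v = "Sv (- 1, 0, 0, 0)"])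
      (simp_all add: mem_K2 vec_eq_0 pair_eq_0 sub2_mem_iff Wv_Zero Ev_Zero del: sub2.simps)
  then show ?thesis by (simp add: m_soc_eq)
qed

text \<open>Here x12 v = y m_o with y nonzero, so v generates the line of m_o besides its own line,
  whose slope is x / y.\<close>

lemma subm_v:
  assumes "y \<noteq> 0"
  shows "subm a {\<Psi> (Ev (y, x))} = N (Line (x / y)) Base"
proof -
  have "subm a (\<Psi> ` {Ev (y, x)}) = N (Line (x / y)) Base"
    by (rule subm_eqI[where v = "Ev (y, x)"])
      (simp_all add: assms mem_K2 vec_eq_0 pair_eq_0 sub2_mem_iff Ev_Line[of _ y x] Wv_Base[of _ y]
        x12_Ev[of _ y x] del: sub2.simps)
  then show ?thesis by simp
qed

lemma subm_w:
  assumes "u \<noteq> 0"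
  shows "subm a {\<Psi> (Wv (u, w))} = N Base (Line (w / u))"
proof -
  have "subm a (\<Psi> ` {Wv (u, w)}) = N Base (Line (w / u))"
    by (rule subm_eqI[where v = "Wv (u, w)"])
      (simp_all add: assms mem_K2 vec_eq_0 pair_eq_0 sub2_mem_iff Wv_Line[of _ u w] Ev_Base[of _ u]
        x12_Wv[of _ u w] del: sub2.simps)
  then show ?thesis by simp
qed

lemma subm_v_set: "(\<lambda>v. subm a {v}) ` v_set a = range (\<lambda>c. N (Line c) Base)"
proof (intro equalityI subsetI)
  fix U assume "U \<in> range (\<lambda>c. N (Line c) Base)"
  then obtain c where "U = subm a {\<Psi> (Ev (1, c))}" by (auto simp: subm_v)
  then show "U \<in> (\<lambda>v. subm a {v}) ` v_set a" by (force simp: v_set_eq)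
qed (auto simp: v_set_eq subm_v)

lemma subm_w_set: "(\<lambda>w. subm a {w}) ` w_set a = range (\<lambda>c. N Base (Line c))"
proof (intro equalityI subsetI)
  fix U assume "U \<in> range (\<lambda>c. N Base (Line c))"
  then obtain c where "U = subm a {\<Psi> (Wv (1, c))}" by (auto simp: subm_w)
  then show "U \<in> (\<lambda>w. subm a {w}) ` w_set a" by (force simp: w_set_eq)
qed (auto simp: w_set_eq subm_w)

lemma subm_v_eq_iff:
  assumes "v \<in> v_set a" "v' \<in> v_set a"
  shows "subm a {v} = subm a {v'} \<longleftrightarrow> v \<in> span_Ver a {v'}"
proof -
  obtain y x y' x' where *: "v = \<Psi> (Ev (y, x))" "v' = \<Psi> (Ev (y', x'))" "y \<noteq> 0" "y' \<noteq> 0"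
    using assms by (auto simp: v_set_eq)
  have "v \<in> span_Ver a {v'} \<longleftrightarrow> (\<exists>c. y = c * y' \<and> x = c * x')"
    by (auto simp: * span_Ver_singleton A.\<Psi>_mem_iff vec_defs)
  also have "\<dots> \<longleftrightarrow> x / y = x' / y'"
    using *(3,4) by (auto simp: field_simps intro!: exI[of _ "y / y'"])
  finally show ?thesis using *(3,4) by (simp add: *(1,2) subm_v N_eq_iff)
qed

lemma subm_w_eq_iff:
  assumes "v \<in> w_set a" "v' \<in> w_set a"
  shows "subm a {v} = subm a {v'} \<longleftrightarrow> v \<in> span_Ver a {v'}"
proof -
  obtain y x y' x' where *: "v = \<Psi> (Wv (y, x))" "v' = \<Psi> (Wv (y', x'))" "y \<noteq> 0" "y' \<noteq> 0"
    using assms by (auto simp: w_set_eq)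
  have "v \<in> span_Ver a {v'} \<longleftrightarrow> (\<exists>c. y = c * y' \<and> x = c * x')"
    by (auto simp: * span_Ver_singleton A.\<Psi>_mem_iff vec_defs)
  also have "\<dots> \<longleftrightarrow> x / y = x' / y'"
    using *(3,4) by (auto simp: field_simps intro!: exI[of _ "y / y'"])
  finally show ?thesis using *(3,4) by (simp add: *(1,2) subm_w N_eq_iff)
qed

subsection \<open>The Hasse diagram\<close>

definition hasse :: "(('k line \<times> 'k line) \<times> S3 \<times> ('k line \<times> 'k line)) set" where
  "hasse =
     {((Full, Full), g12, (Full, Base)), ((Full, Full), 1, (Base, Full)), ((Full, Base), 1, (Base, Base)),
      ((Base, Full), g12, (Base, Base)), ((Base, Base), 1, (Zero, Base)), ((Base, Base), g12, (Base, Zero)),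
      ((Zero, Base), g12, (Zero, Zero)), ((Base, Zero), 1, (Zero, Zero))}
     \<union> (\<Union>c. {((Full, Base), 1, (Line c, Base)), ((Line c, Base), 1, (Zero, Base))})
     \<union> (\<Union>c. {((Base, Full), g12, (Base, Line c)), ((Base, Line c), g12, (Base, Zero))})"

fun below :: "'k line \<times> 'k line \<Rightarrow> 'k line \<times> 'k line \<Rightarrow> bool" where
  "below (E, W) (E', W') \<longleftrightarrow>
     (E = E' \<or> E = Zero \<or> E' = Full) \<and> (W = W' \<or> W = Zero \<or> W' = Full) \<and> (E = E' \<longrightarrow> W \<noteq> W')"

text \<open>The dimension of the subspace; the sum over both planes grades the poset of
  submodules.\<close>

fun rank :: "'k line \<Rightarrow> nat" where
  "rank Zero = 0" | "rank Base = 1" | "rank (Line c) = 1" | "rank Full = 2"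

lemma below_rank: "below (E, W) (E', W') \<Longrightarrow> rank E + rank W < rank E' + rank W'"
  by (cases E; cases W; cases E'; cases W') auto

lemma below_iff: "below p q \<longleftrightarrow> case_prod N p \<subset> case_prod N q"
  by (cases p; cases q) (auto simp: psubset_eq N_subset_iff N_eq_iff)

lemma hasse_cases:
  assumes "(p, h, q) \<in> hasse"
  shows "p \<in> pairs" "q \<in> pairs" "below q p"
    and "rank (fst p) + rank (snd p) = Suc (rank (fst q) + rank (snd q))"
  using assms by (auto simp: hasse_def)

text \<open>An edge raises the total dimension by one, which leaves no room in between. Conversely,
  two comparable nodes not joined by an edge have one of five fixed nodes strictly between them, so
  the families of lines never have to serve as witnesses.\<close>

lemma hasse_iff:
  assumes "p \<in> pairs" "q \<in> pairs"
  shows "(\<exists>h. (p, h, q) \<in> hasse) \<longleftrightarrow> below q p \<and> \<not> (\<exists>r\<in>pairs. below q r \<and> below r p)"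
proof
  assume "\<exists>h. (p, h, q) \<in> hasse"
  then obtain h where pq: "(p, h, q) \<in> hasse" by blast
  have False if "below q r" "below r p" for r
    using hasse_cases(4)[OF pq] that below_rank[of "fst q" "snd q" "fst r" "snd r"]
      below_rank[of "fst r" "snd r" "fst p" "snd p"] by simp
  then show "below q p \<and> \<not> (\<exists>r\<in>pairs. below q r \<and> below r p)"
    using hasse_cases(3)[OF pq] by blast
next
  assume max: "below q p \<and> \<not> (\<exists>r\<in>pairs. below q r \<and> below r p)"
  have "\<not> (below q r \<and> below r p)"
    if "r \<in> {(Zero, Base), (Base, Zero), (Base, Base), (Base, Full), (Full, Base)}" for r
    using max that by (auto simp: pairs_def)
  note this[of "(Zero, Base)", simplified] this[of "(Base, Zero)", simplified] this[of "(Base, Base)", simplified]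
    this[of "(Base, Full)", simplified] this[of "(Full, Base)", simplified]
  note gaps = this max[THEN conjunct1]
  show "\<exists>h. (p, h, q) \<in> hasse"
    using assms gaps unfolding pairs_def
    by (elim UnE UN_E insertE emptyE imageE) (simp_all add: hasse_def)
qed

lemma covers_N:
  "covers (case_prod N ` pairs) = {(case_prod N p, case_prod N q) | p q. \<exists>h. (p, h, q) \<in> hasse}"
proof -
  have image: "{(U, V). U \<in> f ` P \<and> V \<in> f ` P \<and> R V U \<and> \<not> (\<exists>W\<in>f ` P. R V W \<and> R W U)} =
      {(f p, f q) | p q. p \<in> P \<and> q \<in> P \<and> R (f q) (f p) \<and> \<not> (\<exists>r\<in>P. R (f q) (f r) \<and> R (f r) (f p))}"
    for f :: "'x \<Rightarrow> 'y" and P R by auto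
  have "covers (case_prod N ` pairs) =
    {(case_prod N p, case_prod N q) | p q. p \<in> pairs \<and> q \<in> pairs \<and> below q p \<and> \<not> (\<exists>r\<in>pairs. below q r \<and> below r p)}"
    unfolding covers_def below_iff by (rule image)
  also have "\<dots> = {(case_prod N p, case_prod N q) | p q. \<exists>h. (p, h, q) \<in> hasse}"
  proof -
    have "p \<in> pairs \<and> q \<in> pairs \<and> below q p \<and> \<not> (\<exists>r\<in>pairs. below q r \<and> below r p) \<longleftrightarrow>
        (\<exists>h. (p, h, q) \<in> hasse)" for p q
    proof (cases "p \<in> pairs \<and> q \<in> pairs")
      case True
      then show ?thesis by (simp only: hasse_iff simp_thms)
    next
      case False
      then have "(p, h, q) \<notin> hasse" for h using hasse_cases(1,2) by blast
      with False show ?thesis by blast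
    qed
    then show ?thesis by (simp only:)
  qed
  finally show ?thesis .
qed

text \<open>On \<open>K2 E W\<close> the functional \<open>\<l>\<close> turns each generator into
  multiplication by the character of h, so it is a module map onto the one-dimensional module. At h
  = e and h = (12) all f_t vanish, which makes that module well defined.\<close>

lemma quotient_simple:
  assumes "(E, W) \<in> pairs" and h: "h \<in> {1, g12}"
    and add: "\<And>v w. \<l> (v + w) = \<l> v + \<l> w" and scale: "\<And>c v. \<l> (scale c v) = c * \<l> v"
    and act: "\<And>s v. v \<in> K2 E W \<Longrightarrow> \<l> (act b s v) = simple_char h s * \<l> v"
    and one: "v1 \<in> K2 E W" "\<l> v1 = 1"
    and ker: "K2 E' W' = {v \<in> K2 E W. \<l> v = 0}"
  shows "module_isomorphic (alg a) (quotient_module (Ver a\<lparr>carrier := N E W\<rparr>) (N E' W')) (simple_module h)"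
  unfolding N_def
proof (rule A.quotient_isomorphic[OF _ ker])
  show U: "A.stable (K2 E W)" using assms(1) by (simp add: stable_K2_iff)
  show "\<l> ` K2 E W = UNIV"
  proof -
    have "c = \<l> (scale c v1)" "scale c v1 \<in> K2 E W" for c
      using stable_scale[OF U one(1)] by (simp_all add: scale one(2))
    then show ?thesis by blast
  qed
  have f: "f_fun a t h = 0" for t using h by (cases t) (auto simp: f_fun_table[OF a_eq])
  interpret K: letter_action "(*)" "\<lambda>s. (*) (simple_char h s :: 'k)" by (rule letter_action_mult)
  show "\<l> (\<rho> p v) = cls a p \<odot>\<^bsub>simple_module h\<^esub> \<l> v" if "v \<in> K2 E W" for p v
    unfolding simple_module_smult[OF f]
  proof (induction p rule: free_algebra_induct)
    case (letter s p)
    then show ?case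
      using act[OF stable_action[OF U that, of p], of s] by (simp add: V.action_simps K.action_simps)
  qed (simp_all add: V.action_simps K.action_simps add scale)
  show "cls a p \<odot>\<^bsub>simple_module h\<^esub> 0 = 0" for p
    unfolding simple_module_smult[OF f] by (rule K.action_zero_right)
qed (simp_all add: add simple_module_def)

lemma hasse_quotient:
  assumes "(p, h, q) \<in> hasse"
  shows "module_isomorphic (alg a)
    (quotient_module (Ver a\<lparr>carrier := case_prod N p\<rparr>) (case_prod N q)) (simple_module h)"
proof -
  \<comment> \<open>The functional is c1 y + c2 x on M[e]. Since x12 replaces (y, x) by (0, u),
    invariance demands c2 u = 0, that is c2 = 0 or W inside the second axis. The vector of value 1
    is (1, d) or (0, 1).\<close>
  have E: "module_isomorphic (alg a) (quotient_module (Ver a\<lparr>carrier := N E W\<rparr>) (N E' W)) (simple_module 1)"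
    if "(E, W) \<in> pairs" and "(1, d) \<in> sub2 E \<and> c1 + c2 * d = 1 \<or> (0, 1) \<in> sub2 E \<and> c2 = 1"
      and "c2 = 0 \<or> W = Base \<or> W = Zero"
      and "\<And>y x. (y, x) \<in> sub2 E' \<longleftrightarrow> (y, x) \<in> sub2 E \<and> c1 * y + c2 * x = 0"
    for E E' W c1 c2 d
  proof (rule quotient_simple[where \<l> = "\<lambda>v. c1 * fst (fst (snd v)) + c2 * snd (fst (snd v))"
        and ?v1.0 = "Ev (if c2 = 1 \<and> (0, 1) \<in> sub2 E then (0, 1) else (1, d))"])
    fix s v assume "v \<in> K2 E W"
    then obtain y x u w q0 q1 q2 q3 where v: "v = ((0, 0, 0, 0), (y, x), (u, w), (q0, q1, q2, q3))"
      "(u, w) \<in> sub2 W" by (cases v) (auto simp: K2_iff zero_prod_def)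
    with that(3) have "c2 * u = 0" by (auto simp: sub2_mem_iff simp del: sub2.simps)
    then show "c1 * fst (fst (snd (act b s v))) + c2 * snd (fst (snd (act b s v))) =
      simple_char 1 s * (c1 * fst (fst (snd v)) + c2 * snd (fst (snd v)))"
      by (cases s rule: generator_cases) (auto simp: v(1))
  qed (use that in \<open>auto simp: mem_K2 K2_iff algebra_simps vec_defs sub2_closed\<close>)
  have W: "module_isomorphic (alg a) (quotient_module (Ver a\<lparr>carrier := N E W\<rparr>) (N E W')) (simple_module g12)"
    if "(E, W) \<in> pairs" and "(1, d) \<in> sub2 W \<and> c1 + c2 * d = 1 \<or> (0, 1) \<in> sub2 W \<and> c2 = 1"
      and "c2 = 0 \<or> E = Base \<or> E = Zero"
      and "\<And>y x. (y, x) \<in> sub2 W' \<longleftrightarrow> (y, x) \<in> sub2 W \<and> c1 * y + c2 * x = 0"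
    for E W' W c1 c2 d
  proof (rule quotient_simple[where \<l> = "\<lambda>v. c1 * fst (fst (snd (snd v))) + c2 * snd (fst (snd (snd v)))"
        and ?v1.0 = "Wv (if c2 = 1 \<and> (0, 1) \<in> sub2 W then (0, 1) else (1, d))"])
    fix s v assume "v \<in> K2 E W"
    then obtain y x u w q0 q1 q2 q3 where v: "v = ((0, 0, 0, 0), (y, x), (u, w), (q0, q1, q2, q3))"
      "(y, x) \<in> sub2 E" by (cases v) (auto simp: K2_iff zero_prod_def)
    with that(3) have "c2 * y = 0" by (auto simp: sub2_mem_iff simp del: sub2.simps)
    then show "c1 * fst (fst (snd (snd (act b s v)))) + c2 * snd (fst (snd (snd (act b s v)))) =
      simple_char g12 s * (c1 * fst (fst (snd (snd v))) + c2 * snd (fst (snd (snd v))))"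
      by (cases s rule: generator_cases) (auto simp: v(1))
  qed (use that in \<open>auto simp: mem_K2 K2_iff algebra_simps vec_defs sub2_closed\<close>)
  \<comment> \<open>The explicit arguments are d, c1, c2 in this order. The functional is the first
    coordinate for \<open>Full\<close> over \<open>Base\<close> and for \<open>Line c\<close> over
    \<open>Zero\<close>, the second for \<open>Base\<close> over \<open>Zero\<close>, and x - c y
    for \<open>Full\<close> over \<open>Line c\<close>.\<close>
  have e1: "module_isomorphic (alg a) (quotient_module (Ver a\<lparr>carrier := N Full Full\<rparr>) (N Base Full)) (simple_module 1)"
    by (rule E[of _ _ 0 1 0]) (auto simp: sub2_mem_iff simp del: sub2.simps)
  have e2: "module_isomorphic (alg a) (quotient_module (Ver a\<lparr>carrier := N Full Full\<rparr>) (N Full Base)) (simple_module g12)"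
    by (rule W[of _ _ 0 1 0]) (auto simp: sub2_mem_iff simp del: sub2.simps)
  have e3: "module_isomorphic (alg a) (quotient_module (Ver a\<lparr>carrier := N Full Base\<rparr>) (N Base Base)) (simple_module 1)"
    by (rule E[of _ _ 0 1 0]) (auto simp: sub2_mem_iff simp del: sub2.simps)
  have e4: "module_isomorphic (alg a) (quotient_module (Ver a\<lparr>carrier := N Base Full\<rparr>) (N Base Base)) (simple_module g12)"
    by (rule W[of _ _ 0 1 0]) (auto simp: sub2_mem_iff simp del: sub2.simps)
  have e5: "module_isomorphic (alg a) (quotient_module (Ver a\<lparr>carrier := N Base Base\<rparr>) (N Zero Base)) (simple_module 1)"
    by (rule E[of _ _ 0 0 1]) (auto simp: sub2_mem_iff simp del: sub2.simps)
  have e6: "module_isomorphic (alg a) (quotient_module (Ver a\<lparr>carrier := N Base Base\<rparr>) (N Base Zero)) (simple_module g12)"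
    by (rule W[of _ _ 0 0 1]) (auto simp: sub2_mem_iff simp del: sub2.simps)
  have e7: "module_isomorphic (alg a) (quotient_module (Ver a\<lparr>carrier := N Base Zero\<rparr>) (N Zero Zero)) (simple_module 1)"
    by (rule E[of _ _ 0 0 1]) (auto simp: sub2_mem_iff simp del: sub2.simps)
  have e8: "module_isomorphic (alg a) (quotient_module (Ver a\<lparr>carrier := N Zero Base\<rparr>) (N Zero Zero)) (simple_module g12)"
    by (rule W[of _ _ 0 0 1]) (auto simp: sub2_mem_iff simp del: sub2.simps)
  have e9: "module_isomorphic (alg a) (quotient_module (Ver a\<lparr>carrier := N Full Base\<rparr>) (N (Line c) Base)) (simple_module 1)" for c
    by (rule E[of _ _ 0 "- c" 1]) (auto simp: sub2_mem_iff simp del: sub2.simps)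
  have e10: "module_isomorphic (alg a) (quotient_module (Ver a\<lparr>carrier := N Base Full\<rparr>) (N Base (Line c))) (simple_module g12)" for c
    by (rule W[of _ _ 0 "- c" 1]) (auto simp: sub2_mem_iff simp del: sub2.simps)
  have e11: "module_isomorphic (alg a) (quotient_module (Ver a\<lparr>carrier := N (Line c) Base\<rparr>) (N Zero Base)) (simple_module 1)" for c
    by (rule E[of _ _ c 1 0]) (auto simp: sub2_mem_iff simp del: sub2.simps)
  have e12: "module_isomorphic (alg a) (quotient_module (Ver a\<lparr>carrier := N Base (Line c)\<rparr>) (N Base Zero)) (simple_module g12)" for c
    by (rule W[of _ _ c 1 0]) (auto simp: sub2_mem_iff simp del: sub2.simps)
  show ?thesis
    using assms unfolding hasse_def
    by (elim UnE UN_E insertE emptyE) (simp_all add: e1 e2 e3 e4 e5 e6 e7 e8 e9 e10 e11 e12)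
qed

end

theorem lemma18:
  fixes a :: "transp \<Rightarrow> 'k::{alg_closed_field, field_char_0}"
  assumes "a \<in> parameters" and "a T12 \<noteq> a T13" and "a T13 = a T23"
  shows
    "let s12 = perm_of T12;
         ME = subm a (Ver_wt a 1);
         M12 = subm a (Ver_wt a s12);
         S = subm a (span_Ver a {m_o a, mvec a [T12, T23]});
         Mo = subm a {m_o a};
         Mp = subm a {mvec a [T12, T23]};
         Soc = subm a {m_soc a};
         fixed_nodes = [N_1323 a, ME, M12, S, Mo, Mp, Soc];
         nodes = set fixed_nodes \<union> {subm a {v} | v. v \<in> v_set a} \<union> {subm a {w} | w. w \<in> w_set a};
         edges =
           {(N_1323 a, s12, ME), (N_1323 a, 1, M12), (ME, 1, S), (M12, s12, S),
            (S, 1, Mo), (S, s12, Mp), (Mo, s12, Soc), (Mp, 1, Soc)}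
           \<union> (\<Union>v\<in>v_set a. {(ME, 1, subm a {v}), (subm a {v}, 1, Mo)})
           \<union> (\<Union>w\<in>w_set a. {(M12, s12, subm a {w}), (subm a {w}, s12, Mp)})
     in {U. submodule U (alg a) (Ver a) \<and> U \<noteq> {\<zero>\<^bsub>Ver a\<^esub>} \<and> U \<noteq> carrier (Ver a)} = nodes
        \<and> distinct fixed_nodes
        \<and> (\<forall>v\<in>v_set a. subm a {v} \<notin> set fixed_nodes)
        \<and> (\<forall>w\<in>w_set a. subm a {w} \<notin> set fixed_nodes)
        \<and> (\<forall>v\<in>v_set a. \<forall>w\<in>w_set a. subm a {v} \<noteq> subm a {w})
        \<and> covers nodes = {(Y, Z). \<exists>h. (Y, h, Z) \<in> edges}
        \<and> (\<forall>(Y, h, Z)\<in>edges.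
             module_isomorphic (alg a) (quotient_module (Ver a\<lparr>carrier := Y\<rparr>) Z) (simple_module h))
        \<and> (\<forall>v\<in>v_set a. \<forall>v\<^sub>1\<in>v_set a. subm a {v} = subm a {v\<^sub>1} \<longleftrightarrow> v \<in> span_Ver a {v\<^sub>1})
        \<and> (\<forall>w\<in>w_set a. \<forall>w\<^sub>1\<in>w_set a. subm a {w} = subm a {w\<^sub>1} \<longleftrightarrow> w \<in> span_Ver a {w\<^sub>1})"
proof -
  interpret verma_lattice a
    using assms(2,3) by unfold_locales (simp_all add: slope_def)
  let ?edge = "\<lambda>(p, h, q). (case_prod N p, h, case_prod N q)"
  have nodes: "set [N Full Full, N Full Base, N Base Full, N Base Base, N Zero Base, N Base Zero, N Zero Zero]
      \<union> {subm a {v} | v. v \<in> v_set a} \<union> {subm a {w} | w. w \<in> w_set a} = case_prod N ` pairs"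
  proof -
    have "{subm a {v} | v. v \<in> v_set a} = range (\<lambda>c. N (Line c) Base)"
      "{subm a {w} | w. w \<in> w_set a} = range (\<lambda>c. N Base (Line c))"
      using subm_v_set subm_w_set by (simp_all add: setcompr_eq_image)
    then show ?thesis by (simp add: pairs_def image_Un image_image insert_commute)
  qed
  have edges: "{(N Full Full, g12, N Full Base), (N Full Full, 1, N Base Full), (N Full Base, 1, N Base Base),
      (N Base Full, g12, N Base Base), (N Base Base, 1, N Zero Base), (N Base Base, g12, N Base Zero),
      (N Zero Base, g12, N Zero Zero), (N Base Zero, 1, N Zero Zero)}
      \<union> (\<Union>v\<in>v_set a. {(N Full Base, 1, subm a {v}), (subm a {v}, 1, N Zero Base)})
      \<union> (\<Union>w\<in>w_set a. {(N Base Full, g12, subm a {w}), (subm a {w}, g12, N Base Zero)}) = ?edge ` hasse"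
  proof -
    \<comment> \<open>The edges depend on v only through the submodule it generates, so the union
      can be reindexed by the slope c.\<close>
    have "(\<Union>v\<in>v_set a. {(N Full Base, 1, subm a {v}), (subm a {v}, 1, N Zero Base)}) =
        (\<Union>c. {(N Full Base, 1 :: S3, N (Line c) Base), (N (Line c) Base, 1, N Zero Base)})"
      using arg_cong[OF subm_v_set, of "\<lambda>S. \<Union>Y\<in>S. {(N Full Base, 1 :: S3, Y), (Y, 1, N Zero Base)}"]
      by (simp only: image_image)
    moreover have "(\<Union>w\<in>w_set a. {(N Base Full, g12, subm a {w}), (subm a {w}, g12, N Base Zero)}) =
        (\<Union>c. {(N Base Full, g12, N Base (Line c)), (N Base (Line c), g12, N Base Zero)})"
      using arg_cong[OF subm_w_set, of "\<lambda>S. \<Union>Y\<in>S. {(N Base Full, g12, Y), (Y, g12, N Base Zero)}"]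
      by (simp only: image_image)
    ultimately show ?thesis by (simp add: hasse_def image_Un image_UN)
  qed
  have covers: "covers (case_prod N ` pairs) = {(Y, Z). \<exists>h. (Y, h, Z) \<in> ?edge ` hasse}"
    unfolding covers_N by force
  have quotients: "\<forall>(Y, h, Z)\<in>?edge ` hasse.
      module_isomorphic (alg a) (quotient_module (Ver a\<lparr>carrier := Y\<rparr>) Z) (simple_module h)"
    using hasse_quotient by auto
  let ?fixed = "[N Full Full, N Full Base, N Base Full, N Base Base, N Zero Base, N Base Zero, N Zero Zero]"
  have v: "\<exists>c. subm a {v} = N (Line c) Base" if "v \<in> v_set a" for v
    using subm_v_set that by blast
  have w: "\<exists>c. subm a {w} = N Base (Line c)" if "w \<in> w_set a" for w
    using subm_w_set that by blast
  have distinct: "distinct ?fixed" by (simp add: N_eq_iff)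
  have v_fixed: "subm a {v} \<notin> set ?fixed" if "v \<in> v_set a" for v
    using v[OF that] by (auto simp: N_eq_iff)
  have w_fixed: "subm a {w} \<notin> set ?fixed" if "w \<in> w_set a" for w
    using w[OF that] by (auto simp: N_eq_iff)
  have v_w: "subm a {v} \<noteq> subm a {w}" if "v \<in> v_set a" "w \<in> w_set a" for v w
    using v[OF that(1)] w[OF that(2)] by (auto simp: N_eq_iff)
  show ?thesis
    unfolding Let_def N_1323_eq subm_Ver_wt_1 subm_Ver_wt_s12 subm_span_m_o subm_m_o subm_mvec_12_23
      subm_m_soc nodes edges proper_submodules
    by (intro conjI refl distinct covers quotients ballI v_fixed w_fixed v_w subm_v_eq_iff subm_w_eq_iff)
qed

end
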